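(* Let $\mathbb{k}$ be an arbitrary field (not necessarily algebraically closed), let $\mathcal{G}$ and $\hat{\mathcal{G}}$ be finite simple graphs, and let $\mathfrak{g}$ and $\hat{\mathfrak{g}}$ be the solvable Lie algebras over $\mathbb{k}$ constructed from $\mathcal{G}$ and $\hat{\mathcal{G}}$ respectively. Then $\mathfrak{g}$ and $\hat{\mathfrak{g}}$ are isomorphic as Lie algebras over $\mathbb{k}$ if and only if the graphs $\mathcal{G}$ and $\hat{\mathcal{G}}$ are isomorphic.
   Context: Lie algebra constructed from a graph. Let $\mathbb{k}$ be a field and $\mathcal{G}$ a finite simple graph with vertex set $V(\mathcal{G})=\{1,\dots,n\}$, edge set $E(\mathcal{G})$ (edges written $(ij)$), and set of $3$-cliques (triples of pairwise adjacent vertices) $C(\mathcal{G})$, written $(ijk)$ with $i<j<k$. Let $V$ be the $\mathbb{k}$-vector space with basis $\{e_i : i\in V(\mathcal{G})\}$, $W\subset\Lambda^2(V)$ the span of $\{e_i\wedge e_j : (ij)\in E(\mathcal{G})\}$, and $U$ the $\mathbb{k}$-vector space with basis $\{e_{ijk} : (ijk)\in C(\mathcal{G})\}$ (realized in $S^3(V)$ as $e_{ijk}=e_i\odot e_j\odot e_k$). The Lie algebra constructed from $\mathcal{G}$ is $\mathfrak{g}=V\oplus W\oplus U$ with the bilinear alternating bracket whose only nonzero values on pairs of basis elements (up to skew-symmetry) are: $[e_i,e_j]=e_i\wedge e_j$ if $(ij)\in E(\mathcal{G})$; $[e_a,e_{ijk}]=e_a$ if $a\in\{i,j,k\}$; $[e_a\wedge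 e_b,e_{ijk}]=2(e_a\wedge e_b)$ if $\{a,b\}\subset\{i,j,k\}$; $[e_a\wedge e_b,e_{ijk}]=e_a\wedge e_b$ if exactly one of $a,b$ lies in $\{i,j,k\}$; where $(ab)\in E(\mathcal{G})$ and $(ijk)\in C(\mathcal{G})$ in the last three relations as applicable. This is a solvable Lie algebra. *)

theory Defs
  imports
    "HOL-Library.Function_Algebras"
    "Graph_Theory.Digraph_Isomorphism"
    "Graph_Theory.Pair_Digraph"
begin

section \<open>Lie algebras over a field\<close>

text \<open>
  A Lie algebra is carried by a subspace of an ambient vector space; addition is that of the ambient
  type. The alternating law \<open>[x, x] = 0\<close> (rather than skew-symmetry) is what is needed in
  characteristic 2.
\<close>

record ('k, 'a) lie_struct =
  lie_carrier :: "'a set"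
  lie_scale :: "'k \<Rightarrow> 'a \<Rightarrow> 'a"
  lie_bracket :: "'a \<Rightarrow> 'a \<Rightarrow> 'a"

locale lie_algebra =
  fixes L :: "('k::field, 'a::ab_group_add) lie_struct"
  assumes vector_space: "vector_space (lie_scale L)"
    and subspace: "module.subspace (lie_scale L) (lie_carrier L)"
    and bracket_closed:
      "\<lbrakk>x \<in> lie_carrier L; y \<in> lie_carrier L\<rbrakk> \<Longrightarrow> lie_bracket L x y \<in> lie_carrier L"
    and bracket_add_left:
      "\<lbrakk>x \<in> lie_carrier L; y \<in> lie_carrier L; z \<in> lie_carrier L\<rbrakk> \<Longrightarrow>
        lie_bracket L (x + y) z = lie_bracket L x z + lie_bracket L y z"
    and bracket_add_right:
      "\<lbrakk>x \<in> lie_carrier L; y \<in> lie_carrier L; z \<in> lie_carrier L\<rbrakk> \<Longrightarrow>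
        lie_bracket L x (y + z) = lie_bracket L x y + lie_bracket L x z"
    and bracket_scale_left:
      "\<lbrakk>x \<in> lie_carrier L; y \<in> lie_carrier L\<rbrakk> \<Longrightarrow>
        lie_bracket L (lie_scale L c x) y = lie_scale L c (lie_bracket L x y)"
    and bracket_scale_right:
      "\<lbrakk>x \<in> lie_carrier L; y \<in> lie_carrier L\<rbrakk> \<Longrightarrow>
        lie_bracket L x (lie_scale L c y) = lie_scale L c (lie_bracket L x y)"
    and bracket_alternating: "x \<in> lie_carrier L \<Longrightarrow> lie_bracket L x x = 0"
    and jacobi:
      "\<lbrakk>x \<in> lie_carrier L; y \<in> lie_carrier L; z \<in> lie_carrier L\<rbrakk> \<Longrightarrow>
        lie_bracket L (lie_bracket L x y) z + lie_bracket L (lie_bracket L y z) x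
          + lie_bracket L (lie_bracket L z x) y = 0"

definition lie_isomorphism ::
  "('k::field, 'a::ab_group_add) lie_struct \<Rightarrow> ('k, 'b::ab_group_add) lie_struct \<Rightarrow> ('a \<Rightarrow> 'b) \<Rightarrow> bool"
  where
  "lie_isomorphism L M \<phi> \<longleftrightarrow>
     bij_betw \<phi> (lie_carrier L) (lie_carrier M) \<and>
     (\<forall>x \<in> lie_carrier L. \<forall>y \<in> lie_carrier L. \<phi> (x + y) = \<phi> x + \<phi> y) \<and>
     (\<forall>c. \<forall>x \<in> lie_carrier L. \<phi> (lie_scale L c x) = lie_scale M c (\<phi> x)) \<and>
     (\<forall>x \<in> lie_carrier L. \<forall>y \<in> lie_carrier L.
        \<phi> (lie_bracket L x y) = lie_bracket M (\<phi> x) (\<phi> y))"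

definition lie_isomorphic ::
  "('k::field, 'a::ab_group_add) lie_struct \<Rightarrow> ('k, 'b::ab_group_add) lie_struct \<Rightarrow> bool" where
  "lie_isomorphic L M \<longleftrightarrow> (\<exists>\<phi>. lie_isomorphism L M \<phi>)"


section \<open>The Lie algebra constructed from a graph\<close>

text \<open>
  A finite simple graph is a \<^locale>\<open>pair_graph\<close>: finite, loop-free and symmetric, so that
  an undirected edge \<open>(ij)\<close> is the pair of arcs \<open>(i, j)\<close> and \<open>(j, i)\<close>.

  Elements of \<open>V \<oplus> \<Lambda>\<^sup>2(V) \<oplus> S\<^sup>3(V)\<close> are given by their coordinates with respect to
  \<open>e\<^sub>i\<close>, to \<open>e\<^sub>i \<and> e\<^sub>j\<close> with \<open>i < j\<close>, and to
  \<open>e\<^sub>i \<odot> e\<^sub>j \<odot> e\<^sub>k\<close> with \<open>i < j < k\<close>; \<open>V \<oplus> W \<oplus> U\<close> is the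
  subspace of the vectors supported on the vertices, edges and 3-cliques of the graph. The vertex type
  is linearly ordered only to have such a choice of indices.
\<close>

datatype 'v basis_index = Vert 'v | Wedge 'v 'v | Clique 'v 'v 'v

definition graph_basis :: "'v::linorder pair_pre_digraph \<Rightarrow> 'v basis_index set" where
  "graph_basis G =
     Vert ` pverts G
     \<union> {Wedge i j | i j. i < j \<and> (i, j) \<in> parcs G}
     \<union> {Clique i j k | i j k. i < j \<and> j < k \<and>
          (i, j) \<in> parcs G \<and> (i, k) \<in> parcs G \<and> (j, k) \<in> parcs G}"

definition scale_fun :: "'k::field \<Rightarrow> ('b \<Rightarrow> 'k) \<Rightarrow> 'b \<Rightarrow> 'k" where
  "scale_fun c x = (\<lambda>b. c * x b)"

definition unit_vec :: "'b \<Rightarrow> 'b \<Rightarrow> 'k::field" where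
  "unit_vec b = (\<lambda>b'. if b' = b then 1 else 0)"

text \<open>\<open>e\<^sub>i \<and> e\<^sub>j\<close>, for \<open>i\<close> and \<open>j\<close> in any order\<close>

definition wedge_vec :: "'v::linorder \<Rightarrow> 'v \<Rightarrow> 'v basis_index \<Rightarrow> 'k::field" where
  "wedge_vec i j =
     (if i < j then unit_vec (Wedge i j) else if j < i then - unit_vec (Wedge j i) else 0)"

fun basis_bracket :: "'v::linorder pair_pre_digraph \<Rightarrow> 'v basis_index \<Rightarrow> 'v basis_index \<Rightarrow>
    'v basis_index \<Rightarrow> 'k::field" where
  "basis_bracket G (Vert i) (Vert j) = (if (i, j) \<in> parcs G then wedge_vec i j else 0)"
| "basis_bracket G (Vert a) (Clique i j k) = (if a \<in> {i, j, k} then unit_vec (Vert a) else 0)"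
| "basis_bracket G (Wedge a b) (Clique i j k) =
     (if a \<in> {i, j, k} \<and> b \<in> {i, j, k} then scale_fun 2 (unit_vec (Wedge a b))
      else if a \<in> {i, j, k} \<or> b \<in> {i, j, k} then unit_vec (Wedge a b)
      else 0)"
| "basis_bracket G (Clique i j k) (Vert a) = (if a \<in> {i, j, k} then - unit_vec (Vert a) else 0)"
| "basis_bracket G (Clique i j k) (Wedge a b) =
     (if a \<in> {i, j, k} \<and> b \<in> {i, j, k} then - scale_fun 2 (unit_vec (Wedge a b))
      else if a \<in> {i, j, k} \<or> b \<in> {i, j, k} then - unit_vec (Wedge a b)
      else 0)"
| "basis_bracket G _ _ = 0"

definition graph_bracket :: "'v::linorder pair_pre_digraph \<Rightarrow>
    ('v basis_index \<Rightarrow> 'k::field) \<Rightarrow> ('v basis_index \<Rightarrow> 'k) \<Rightarrow> 'v basis_index \<Rightarrow> 'k" where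
  "graph_bracket G x y =
     (\<Sum>p \<in> graph_basis G. \<Sum>q \<in> graph_basis G. scale_fun (x p * y q) (basis_bracket G p q))"

definition graph_lie_algebra ::
  "'v::linorder pair_pre_digraph \<Rightarrow> ('k::field, 'v basis_index \<Rightarrow> 'k) lie_struct" where
  "graph_lie_algebra G =
     \<lparr> lie_carrier = {x. \<forall>b. b \<notin> graph_basis G \<longrightarrow> x b = 0},
       lie_scale = scale_fun,
       lie_bracket = graph_bracket G \<rparr>"


section \<open>Well-definedness\<close>

lemma vector_space_scale_fun: "vector_space scale_fun"
  by unfold_locales (auto simp: scale_fun_def fun_eq_iff algebra_simps)

lemma sum_fun_apply: "(\<Sum>a\<in>A. f a) b = (\<Sum>a\<in>A. (f a b :: 'k::comm_monoid_add))"
  by (induction A rule: infinite_finite_induct) auto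

lemma graph_bracket_apply:
  "graph_bracket G x y b =
    (\<Sum>p \<in> graph_basis G. \<Sum>q \<in> graph_basis G. x p * y q * basis_bracket G p q b)"
  by (simp add: graph_bracket_def sum_fun_apply scale_fun_def)

lemma finite_graph_basis:
  assumes "pair_graph G"
  shows "finite (graph_basis G)"
proof -
  interpret pair_graph G by fact
  let ?V = "pverts G"
  have "graph_basis G \<subseteq> Vert ` ?V \<union> (\<lambda>(i, j). Wedge i j) ` (?V \<times> ?V)
      \<union> (\<lambda>(i, j, k). Clique i j k) ` (?V \<times> ?V \<times> ?V)"
    by (auto simp: graph_basis_def image_iff dest: in_arcsD1 in_arcsD2)
  thus ?thesis
    by (rule finite_subset) (use pair_finite_verts in auto)
qed

lemma graph_bracket_unit_vec:
  assumes "pair_graph G" "p \<in> graph_basis G" "q \<in> graph_basis G"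
  shows "graph_bracket G (unit_vec p) (unit_vec q) = (basis_bracket G p q :: _ \<Rightarrow> 'k::field)"
proof
  fix b
  have "graph_bracket G (unit_vec p) (unit_vec q) b =
      (\<Sum>p' \<in> graph_basis G. \<Sum>q' \<in> graph_basis G.
         if p' = p then if q' = q then (basis_bracket G p q b :: 'k) else 0 else 0)"
    unfolding graph_bracket_apply by (intro sum.cong refl) (auto simp: unit_vec_def)
  also have "\<dots> = (\<Sum>p' \<in> graph_basis G. if p' = p then
      (\<Sum>q' \<in> graph_basis G. if q' = q then (basis_bracket G p q b :: 'k) else 0) else 0)"
    by (intro sum.cong) auto
  also have "\<dots> = basis_bracket G p q b"
    using assms finite_graph_basis[OF assms(1)] by simp
  finally show "graph_bracket G (unit_vec p) (unit_vec q) b = (basis_bracket G p q b :: 'k)" .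
qed

lemma in_graph_basis [simp]:
  "Vert i \<in> graph_basis G \<longleftrightarrow> i \<in> pverts G"
  "Wedge i j \<in> graph_basis G \<longleftrightarrow> i < j \<and> (i, j) \<in> parcs G"
  "Clique i j k \<in> graph_basis G \<longleftrightarrow> i < j \<and> j < k \<and>
     (i, j) \<in> parcs G \<and> (i, k) \<in> parcs G \<and> (j, k) \<in> parcs G"
  by (auto simp: graph_basis_def)

lemma basis_bracket_support:
  assumes "pair_graph G" "p \<in> graph_basis G" "q \<in> graph_basis G" "b \<notin> graph_basis G"
  shows "basis_bracket G p q b = 0"
proof -
  interpret pair_graph G by fact
  have sym: "(j, i) \<in> parcs G \<longleftrightarrow> (i, j) \<in> parcs G" for i j
    using pair_sym_arcs by (auto simp: symmetric_def sym_def)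
  have u: "unit_vec c b = (0 :: 'b)" if "c \<in> graph_basis G" for c
    using that assms(4) by (auto simp: unit_vec_def)
  show ?thesis
    using assms(2,3)
    by (cases p; cases q) (simp_all add: u wedge_vec_def scale_fun_def sym)
qed

lemma basis_bracket_same: "basis_bracket G p p = 0"
  by (cases p) (auto simp: wedge_vec_def)

lemma basis_bracket_skew:
  assumes "pair_graph G"
  shows "basis_bracket G q p b = - (basis_bracket G p q b :: 'k::field)"
proof -
  interpret pair_graph G by fact
  have sym: "(i, j) \<in> parcs G \<longleftrightarrow> (j, i) \<in> parcs G" for i j
    using pair_sym_arcs by (auto simp: symmetric_def sym_def)
  show ?thesis
    by (cases p; cases q) (auto simp: wedge_vec_def sym)
qed

lemma sum_alternating:
  fixes f :: "'b \<Rightarrow> 'b \<Rightarrow> 'k::field"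
  assumes "finite A" "\<And>p. f p p = 0" "\<And>p q. f q p = - f p q"
  shows "(\<Sum>p\<in>A. \<Sum>q\<in>A. f p q) = 0"
  using assms(1)
proof (induction A rule: finite_induct)
  case (insert a A)
  have "(\<Sum>q\<in>A. f a q) + (\<Sum>p\<in>A. f p a) = (\<Sum>p\<in>A. f a p + f p a)"
    by (simp add: sum.distrib)
  also have "\<dots> = 0"
    using assms(3)[of a] by (intro sum.neutral) auto
  finally show ?case
    using insert by (simp add: assms(2) sum.distrib add.commute)
qed auto

lemma graph_bracket_expand_left:
  assumes "pair_graph G"
  shows "graph_bracket G (graph_bracket G x y) z b =
    (\<Sum>p \<in> graph_basis G. \<Sum>q \<in> graph_basis G. \<Sum>r \<in> graph_basis G.
       x p * y q * z r * graph_bracket G (basis_bracket G p q) (unit_vec r) b)"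
proof -
  let ?B = "graph_basis G"
  have fin: "finite ?B" by (rule finite_graph_basis[OF assms])
  have *: "graph_bracket G w (unit_vec r) b = (\<Sum>s\<in>?B. w s * basis_bracket G s r b)"
    if "r \<in> ?B" for w r
  proof -
    have "w p * unit_vec r q * basis_bracket G p q b
        = (if q = r then w p * basis_bracket G p r b else 0)" for p q
      by (simp add: unit_vec_def)
    thus ?thesis using that fin by (simp add: graph_bracket_apply)
  qed
  have "graph_bracket G (graph_bracket G x y) z b =
      (\<Sum>s\<in>?B. \<Sum>r\<in>?B. \<Sum>p\<in>?B. \<Sum>q\<in>?B.
         x p * y q * z r * (basis_bracket G p q s * basis_bracket G s r b))"
    unfolding graph_bracket_apply[of G "graph_bracket G x y"] graph_bracket_apply[of G x y]
    by (simp add: sum_distrib_right sum_distrib_left mult_ac)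
  also have "\<dots> = (\<Sum>r\<in>?B. \<Sum>s\<in>?B. \<Sum>p\<in>?B. \<Sum>q\<in>?B.
         x p * y q * z r * (basis_bracket G p q s * basis_bracket G s r b))"
    by (rule sum.swap)
  also have "\<dots> = (\<Sum>r\<in>?B. \<Sum>p\<in>?B. \<Sum>s\<in>?B. \<Sum>q\<in>?B.
         x p * y q * z r * (basis_bracket G p q s * basis_bracket G s r b))"
    by (rule sum.cong[OF refl], rule sum.swap)
  also have "\<dots> = (\<Sum>p\<in>?B. \<Sum>r\<in>?B. \<Sum>s\<in>?B. \<Sum>q\<in>?B.
         x p * y q * z r * (basis_bracket G p q s * basis_bracket G s r b))"
    by (rule sum.swap)
  also have "\<dots> = (\<Sum>p\<in>?B. \<Sum>r\<in>?B. \<Sum>q\<in>?B. \<Sum>s\<in>?B.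
         x p * y q * z r * (basis_bracket G p q s * basis_bracket G s r b))"
    by (rule sum.cong[OF refl], rule sum.cong[OF refl], rule sum.swap)
  also have "\<dots> = (\<Sum>p\<in>?B. \<Sum>q\<in>?B. \<Sum>r\<in>?B. \<Sum>s\<in>?B.
         x p * y q * z r * (basis_bracket G p q s * basis_bracket G s r b))"
    by (rule sum.cong[OF refl], rule sum.swap)
  also have "\<dots> = (\<Sum>p\<in>?B. \<Sum>q\<in>?B. \<Sum>r\<in>?B.
       x p * y q * z r * graph_bracket G (basis_bracket G p q) (unit_vec r) b)"
    by (intro sum.cong refl) (simp add: * sum_distrib_left)
  finally show ?thesis .
qed

lemma graph_bracket_scale_left:
  "graph_bracket G (scale_fun c x) y = scale_fun c (graph_bracket G x y)"
  by (rule ext) (simp add: graph_bracket_apply scale_fun_def sum_distrib_left mult.assoc)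

lemma graph_bracket_scale_right:
  "graph_bracket G x (scale_fun c y) = scale_fun c (graph_bracket G x y)"
  by (rule ext) (simp add: graph_bracket_apply scale_fun_def sum_distrib_left mult_ac)

lemma graph_bracket_uminus_left: "graph_bracket G (- x) y = - graph_bracket G x y"
  by (rule ext) (simp add: graph_bracket_apply sum_negf)

lemma graph_bracket_zero_left: "graph_bracket G 0 y = 0"
  by (rule ext) (simp add: graph_bracket_apply)

lemma jacobi_basis:
  assumes G: "pair_graph G"
    and pqr: "p \<in> graph_basis G" "q \<in> graph_basis G" "r \<in> graph_basis G"
  shows "graph_bracket G (basis_bracket G p q) (unit_vec r) b
    + graph_bracket G (basis_bracket G q r) (unit_vec p) b
    + graph_bracket G (basis_bracket G r p) (unit_vec q) b = (0 :: 'k::field)"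
proof -
  interpret pair_graph G by fact
  have sym: "(j, i) \<in> parcs G \<longleftrightarrow> (i, j) \<in> parcs G" for i j
    using pair_sym_arcs by (auto simp: symmetric_def sym_def)
  define wt :: "'a \<Rightarrow> 'a \<Rightarrow> 'a \<Rightarrow> 'a \<Rightarrow> 'k"
    where "wt a i j k = (if a \<in> {i, j, k} then 1 else 0)" for a i j k
  have VC: "basis_bracket G (Vert a) (Clique i j k) = scale_fun (wt a i j k) (unit_vec (Vert a))"
    and CV: "basis_bracket G (Clique i j k) (Vert a) = scale_fun (- wt a i j k) (unit_vec (Vert a))"
    for a i j k
    by (auto simp: wt_def scale_fun_def)
  have WC: "basis_bracket G (Wedge a c) (Clique i j k) =
      scale_fun (wt a i j k + wt c i j k) (unit_vec (Wedge a c))"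
    and CW: "basis_bracket G (Clique i j k) (Wedge a c) =
      scale_fun (- wt a i j k - wt c i j k) (unit_vec (Wedge a c))"
    for a c i j k
    by (auto simp: wt_def scale_fun_def)
  note U = graph_bracket_unit_vec[OF G]
  note S = graph_bracket_scale_left graph_bracket_uminus_left graph_bracket_zero_left
  have VVr: "graph_bracket G (basis_bracket G (Vert a) (Vert c)) (unit_vec r) =
      (case r of Clique i j k \<Rightarrow>
          scale_fun (wt a i j k + wt c i j k) (basis_bracket G (Vert a) (Vert c)) | _ \<Rightarrow> 0)"
    if "r \<in> graph_basis G" for a c r
  proof (cases r)
    case (Clique i j k)
    have "graph_bracket G (unit_vec (Wedge a c)) (unit_vec r) =
        scale_fun (wt a i j k + wt c i j k) (unit_vec (Wedge a c))" if "(a, c) \<in> parcs G" "a < c" for a c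
      using that \<open>r \<in> graph_basis G\<close> unfolding Clique by (subst U) (simp_all only: in_graph_basis WC)
    thus ?thesis
      using Clique by (auto simp: wedge_vec_def S sym scale_fun_def algebra_simps)
  next
    case (Vert i)
    thus ?thesis using that by (auto simp: wedge_vec_def S U sym)
  next
    case (Wedge i j)
    thus ?thesis using that by (auto simp: wedge_vec_def S U sym)
  qed
  note basis_bracket.simps(1-5) [simp del]
  have skew: "basis_bracket G p q b = - (basis_bracket G q p b :: 'k)"
    "basis_bracket G q r b = - (basis_bracket G r q b :: 'k)"
    "basis_bracket G r p b = - (basis_bracket G p r b :: 'k)"
    by (rule basis_bracket_skew[OF G])+
  note basis_bracket.simps(2-5) [simp del]
  show ?thesis
    using pqr skew
    by (cases p; cases q; cases r;
        simp add: VVr VC CV WC CW S U;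
        simp add: scale_fun_def algebra_simps)
qed

lemma graph_bracket_same:
  assumes G: "pair_graph G"
  shows "graph_bracket G x x = 0"
proof
  fix b
  have "graph_bracket G x x b =
      (\<Sum>p \<in> graph_basis G. \<Sum>q \<in> graph_basis G. x p * x q * basis_bracket G p q b)"
    by (rule graph_bracket_apply)
  also have "\<dots> = 0"
  proof (rule sum_alternating[OF finite_graph_basis[OF G]])
    fix p q
    show "x p * x p * basis_bracket G p p b = 0"
      by (simp add: basis_bracket_same)
    show "x q * x p * basis_bracket G q p b = - (x p * x q * basis_bracket G p q b)"
      by (subst basis_bracket_skew[OF G]) (simp add: mult_ac)
  qed
  finally show "graph_bracket G x x b = 0 b" by simp
qed

lemma graph_bracket_jacobi:
  assumes G: "pair_graph G"
  shows "graph_bracket G (graph_bracket G x y) z + graph_bracket G (graph_bracket G y z) x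
    + graph_bracket G (graph_bracket G z x) y = 0"
proof
  fix b
  let ?B = "graph_basis G"
  let ?J = "\<lambda>p q r. graph_bracket G (basis_bracket G p q) (unit_vec r) b"
  have 1: "graph_bracket G (graph_bracket G x y) z b =
      (\<Sum>p\<in>?B. \<Sum>q\<in>?B. \<Sum>r\<in>?B. x p * y q * z r * ?J p q r)"
    by (rule graph_bracket_expand_left[OF G])
  have "graph_bracket G (graph_bracket G y z) x b =
      (\<Sum>q\<in>?B. \<Sum>r\<in>?B. \<Sum>p\<in>?B. y q * z r * x p * ?J q r p)"
    by (rule graph_bracket_expand_left[OF G])
  also have "\<dots> = (\<Sum>q\<in>?B. \<Sum>p\<in>?B. \<Sum>r\<in>?B. y q * z r * x p * ?J q r p)"
    by (rule sum.cong[OF refl], rule sum.swap)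
  also have "\<dots> = (\<Sum>p\<in>?B. \<Sum>q\<in>?B. \<Sum>r\<in>?B. y q * z r * x p * ?J q r p)"
    by (rule sum.swap)
  finally have 2: "graph_bracket G (graph_bracket G y z) x b = \<dots>" .
  have "graph_bracket G (graph_bracket G z x) y b =
      (\<Sum>r\<in>?B. \<Sum>p\<in>?B. \<Sum>q\<in>?B. z r * x p * y q * ?J r p q)"
    by (rule graph_bracket_expand_left[OF G])
  also have "\<dots> = (\<Sum>p\<in>?B. \<Sum>r\<in>?B. \<Sum>q\<in>?B. z r * x p * y q * ?J r p q)"
    by (rule sum.swap)
  also have "\<dots> = (\<Sum>p\<in>?B. \<Sum>q\<in>?B. \<Sum>r\<in>?B. z r * x p * y q * ?J r p q)"
    by (rule sum.cong[OF refl], rule sum.swap)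
  finally have 3: "graph_bracket G (graph_bracket G z x) y b = \<dots>" .
  have "graph_bracket G (graph_bracket G x y) z b + graph_bracket G (graph_bracket G y z) x b
      + graph_bracket G (graph_bracket G z x) y b =
      (\<Sum>p\<in>?B. \<Sum>q\<in>?B. \<Sum>r\<in>?B. x p * y q * z r * (?J p q r + ?J q r p + ?J r p q))"
    unfolding 1 2 3 sum.distrib[symmetric] by (intro sum.cong refl) (simp add: algebra_simps)
  also have "\<dots> = 0"
    by (intro sum.neutral ballI) (simp add: jacobi_basis[OF G])
  finally show "(graph_bracket G (graph_bracket G x y) z + graph_bracket G (graph_bracket G y z) x
      + graph_bracket G (graph_bracket G z x) y) b = 0 b"
    by simp
qed

theorem lie_algebra_graph_lie_algebra:
  assumes G: "pair_graph G"
  shows "lie_algebra (graph_lie_algebra G :: ('k::field, _) lie_struct)"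
proof -
  interpret vector_space "scale_fun :: 'k \<Rightarrow> ('a basis_index \<Rightarrow> 'k) \<Rightarrow> _"
    by (rule vector_space_scale_fun)
  have closed: "graph_bracket G x y b = (0 :: 'k)" if "b \<notin> graph_basis G" for x y b
    by (simp add: graph_bracket_apply basis_bracket_support[OF G _ _ that])
  have add_left: "graph_bracket G (x + y) z = graph_bracket G x z + graph_bracket G y z"
    and add_right: "graph_bracket G x (y + z) = graph_bracket G x y + graph_bracket G x z"
    for x y z :: "'a basis_index \<Rightarrow> 'k"
    by (rule ext; simp add: graph_bracket_apply sum.distrib algebra_simps)+
  have "subspace {x. \<forall>b. b \<notin> graph_basis G \<longrightarrow> x b = 0}"
    by (auto simp: subspace_def scale_fun_def)
  thus ?thesis
    by (intro lie_algebra.intro)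
      (simp_all add: graph_lie_algebra_def vector_space_scale_fun closed add_left add_right
        graph_bracket_scale_left graph_bracket_scale_right graph_bracket_same[OF G]
        graph_bracket_jacobi[OF G])
qed

section \<open>Graph isomorphism\<close>

lemma digraph_iso_pair_graph_iff:
  assumes G: "pair_graph G" and H: "pair_graph H"
  shows "digraph_iso (with_proj G) (with_proj H) \<longleftrightarrow>
    (\<exists>f. bij_betw f (pverts G) (pverts H) \<and>
       (\<forall>i \<in> pverts G. \<forall>j \<in> pverts G. (i, j) \<in> parcs G \<longleftrightarrow> (f i, f j) \<in> parcs H))"
    (is "?L \<longleftrightarrow> ?R")
proof
  interpret G: pair_graph G by fact
  interpret H: pair_graph H by fact
  {
    assume ?L
    then obtain h where h: "pre_digraph.digraph_isomorphism (with_proj G) h"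
      and eq: "with_proj H = app_iso h (with_proj G)"
      by (auto simp: digraph_iso_def)
    have V: "pverts H = iso_verts h ` pverts G" and E: "parcs H = iso_arcs h ` parcs G"
      and t: "iso_tail h = fst" and hd: "iso_head h = snd"
      using eq by (auto simp: app_iso_def with_proj_def)
    have inj: "inj_on (iso_verts h) (pverts G)"
      and ends: "\<And>a. a \<in> parcs G \<Longrightarrow> iso_arcs h a = (iso_verts h (fst a), iso_verts h (snd a))"
      using h t hd by (auto simp: pre_digraph.digraph_isomorphism_def prod_eq_iff)
    have "(i, j) \<in> parcs G \<longleftrightarrow> (iso_verts h i, iso_verts h j) \<in> parcs H"
      if ij: "i \<in> pverts G" "j \<in> pverts G" for i j
    proof
      assume "(i, j) \<in> parcs G"
      thus "(iso_verts h i, iso_verts h j) \<in> parcs H"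
        using E ends[of "(i, j)"] by force
    next
      assume "(iso_verts h i, iso_verts h j) \<in> parcs H"
      then obtain a where a: "a \<in> parcs G" "iso_verts h i = iso_verts h (fst a)"
          "iso_verts h j = iso_verts h (snd a)"
        using E ends by auto
      hence "i = fst a" "j = snd a"
        using inj ij G.arc_fst_in_verts G.arc_snd_in_verts by (auto dest: inj_onD)
      thus "(i, j) \<in> parcs G" using a by simp
    qed
    thus ?R using V inj by (auto simp: bij_betw_def)
  next
    assume ?R
    then obtain f where f: "bij_betw f (pverts G) (pverts H)"
      and adj: "\<And>i j. i \<in> pverts G \<Longrightarrow> j \<in> pverts G \<Longrightarrow> (i, j) \<in> parcs G \<longleftrightarrow> (f i, f j) \<in> parcs H"
      by blast
    define h where "h = \<lparr> iso_verts = f, iso_arcs = map_prod f f, iso_head = snd, iso_tail = fst \<rparr>"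
    have inj: "inj_on f (pverts G)" and im: "f ` pverts G = pverts H"
      using f by (auto simp: bij_betw_def)
    have "inj_on (map_prod f f) (parcs G)"
      using inj by (intro inj_on_subset[OF map_prod_inj_on[OF inj inj]])
        (auto dest: G.in_arcsD1 G.in_arcsD2)
    hence "pre_digraph.digraph_isomorphism (with_proj G) h"
      using inj G.wf_digraph by (auto simp: pre_digraph.digraph_isomorphism_def h_def)
    moreover have "parcs H = map_prod f f ` parcs G"
    proof (intro equalityI subsetI)
      fix a assume a: "a \<in> parcs H"
      then obtain i j where "i \<in> pverts G" "j \<in> pverts G" "a = (f i, f j)"
        using im H.in_arcsD1 H.in_arcsD2 by (metis imageE surj_pair)
      thus "a \<in> map_prod f f ` parcs G"
        using a adj by (intro image_eqI[of _ _ "(i, j)"]) simp_all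
    next
      fix a assume "a \<in> map_prod f f ` parcs G"
      then obtain i j where "(i, j) \<in> parcs G" "a = (f i, f j)" by auto
      thus "a \<in> parcs H" using adj G.in_arcsD1 G.in_arcsD2 by blast
    qed
    hence "with_proj H = app_iso h (with_proj G)"
      using im by (simp add: with_proj_def app_iso_def h_def)
    ultimately show ?L by (auto simp: digraph_iso_def)
  }
qed

end

theory Submission
  imports Defs
begin

text \<open>
  The elements \<open>x\<close> with \<open>(ad x)\<^sup>3 = 0\<close> form \<open>V \<oplus> W \<oplus> U\<^sub>0\<close>, where \<open>U\<^sub>0 \<subseteq> U\<close> consists of the
  elements acting trivially on \<open>V\<close>. The quotient of this subalgebra by its center has a basis indexed by
  the vertices incident to an edge, and on it \<open>[x, y] = 0\<close> means \<open>x\<^sub>i y\<^sub>j = x\<^sub>j y\<^sub>i\<close> for all edges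
  \<open>(ij)\<close>. A Lie isomorphism therefore yields an invertible matrix \<open>a\<close> preserving this commutation
  relation. Choose a bijection \<open>\<sigma>\<close> of the vertices with \<open>a i (\<sigma> i) \<noteq> 0\<close> for all \<open>i\<close>. Comparing the
  dimensions of centralizers gives \<open>deg (\<sigma> i) \<le> deg i\<close>, with equality by symmetry of the situation;
  equality forces \<open>N(k) \<subseteq> N[\<sigma> i]\<close> whenever \<open>a i k \<noteq> 0\<close>. So up to \<open>\<sigma>\<close> the matrix is block triangular
  for the domination preorder, and this makes \<open>\<sigma>\<close> a graph isomorphism. The isolated vertices are
  recovered from the dimension of the Lie algebra.
\<close>

section \<open>Matrices with trivial kernel\<close>

definition matrix_image :: "('i \<Rightarrow> 'j \<Rightarrow> 'k::field) \<Rightarrow> 'i set \<Rightarrow> ('i \<Rightarrow> 'k) \<Rightarrow> 'j \<Rightarrow> 'k" where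
  "matrix_image a I x j = (\<Sum>i\<in>I. x i * a i j)"

text \<open>For finite \<open>I\<close> this is linear independence of the rows \<open>a i\<close>,
  \<open>i \<in> I\<close>, cut down to the columns in \<open>J\<close>. Explicit index sets let
  rows and columns be dropped without changing the matrix.\<close>

definition trivial_kernel :: "('i \<Rightarrow> 'j \<Rightarrow> 'k::field) \<Rightarrow> 'i set \<Rightarrow> 'j set \<Rightarrow> bool" where
  "trivial_kernel a I J \<longleftrightarrow>
     (\<forall>x. (\<forall>j\<in>J. matrix_image a I x j = 0) \<longrightarrow> (\<forall>i\<in>I. x i = 0))"

lemma trivial_kernelD:
  "\<lbrakk>trivial_kernel a I J; \<And>j. j \<in> J \<Longrightarrow> matrix_image a I x j = 0; i \<in> I\<rbrakk> \<Longrightarrow> x i = 0"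
  unfolding trivial_kernel_def by blast

lemma matrix_image_unit_vec:
  "\<lbrakk>finite I; i \<in> I\<rbrakk> \<Longrightarrow> matrix_image a I (unit_vec i) = a i"
  by (rule ext) (simp add: matrix_image_def unit_vec_def if_distrib[of "\<lambda>c. c * _"] cong: if_cong)

lemma matrix_image_restrict:
  assumes "finite I" "I' \<subseteq> I"
  shows "matrix_image a I (\<lambda>i. if i \<in> I' then x i else 0) = matrix_image a I' x"
proof
  fix j
  have "matrix_image a I (\<lambda>i. if i \<in> I' then x i else 0) j
      = (\<Sum>i\<in>I. if i \<in> I' then x i * a i j else 0)"
    unfolding matrix_image_def by (intro sum.cong) auto
  also have "\<dots> = matrix_image a I' x j"
    using assms by (simp add: matrix_image_def sum.inter_restrict[symmetric] Int_absorb1)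
  finally show "matrix_image a I (\<lambda>i. if i \<in> I' then x i else 0) j = matrix_image a I' x j" .
qed

text \<open>
  In the induction step the row \<open>i\<close> is matched with a column \<open>j\<close> whose removal leaves the other rows
  independent. If there were none, every unit vector \<open>e\<^sub>j\<close> with \<open>a i j \<noteq> 0\<close>, and hence the row
  \<open>i\<close> itself, would be in the span of the other rows.
\<close>

lemma trivial_kernel_imp_matching:
  assumes "finite I" "finite J" "trivial_kernel (a :: 'i \<Rightarrow> 'j \<Rightarrow> 'k::field) I J"
  shows "\<exists>\<sigma>. inj_on \<sigma> I \<and> \<sigma> ` I \<subseteq> J \<and> (\<forall>i\<in>I. a i (\<sigma> i) \<noteq> 0)"
  using assms
proof (induction I arbitrary: J rule: finite_induct)
  case empty
  show ?case by simp
next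
  case (insert i I)
  have split: "matrix_image a (insert i I) x j = x i * a i j + matrix_image a I x j" for x j
    using insert.hyps by (simp add: matrix_image_def)
  have cong: "matrix_image a I (x(i := c)) = matrix_image a I x" for x c
    using insert.hyps(2) unfolding matrix_image_def by (intro ext sum.cong) auto
  have "\<exists>j\<in>J. a i j \<noteq> 0 \<and> trivial_kernel a I (J - {j})"
  proof (rule ccontr)
    assume "\<not> ?thesis"
    hence no: "\<not> trivial_kernel a I (J - {j})" if "j \<in> J" "a i j \<noteq> 0" for j
      using that by blast
    have "\<exists>u. \<forall>l\<in>J. matrix_image a I u l = unit_vec j l" if j: "j \<in> J" "a i j \<noteq> 0" for j
    proof -
      from no[OF j] obtain x i' where x: "\<And>l. l \<in> J - {j} \<Longrightarrow> matrix_image a I x l = 0"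
        and i': "i' \<in> I" "x i' \<noteq> 0"
        unfolding trivial_kernel_def by blast
      \<comment> \<open>Otherwise \<open>x\<close>, set to zero at \<open>i\<close>, would be a
        kernel vector of all the rows.\<close>
      have c: "matrix_image a I x j \<noteq> 0"
      proof
        assume "matrix_image a I x j = 0"
        hence "\<And>l. l \<in> J \<Longrightarrow> matrix_image a (insert i I) (x(i := 0)) l = 0"
          using x by (simp add: split cong) (metis DiffI singletonD)
        hence "(x(i := 0)) i' = 0"
          using trivial_kernelD[OF insert.prems(2)] i' by blast
        thus False using i' insert.hyps(2) by (auto split: if_splits)
      qed
      have "matrix_image a I (\<lambda>i. x i / matrix_image a I x j) l = unit_vec j l" if "l \<in> J" for l
      proof -
        have "matrix_image a I (\<lambda>i. x i / matrix_image a I x j) l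
            = matrix_image a I x l / matrix_image a I x j"
          by (simp add: matrix_image_def sum_divide_distrib)
        thus ?thesis using x[of l] that c by (auto simp: unit_vec_def)
      qed
      thus ?thesis by blast
    qed
    then obtain u where u: "\<And>j l. \<lbrakk>j \<in> J; a i j \<noteq> 0; l \<in> J\<rbrakk> \<Longrightarrow> matrix_image a I (u j) l = unit_vec j l"
      by metis
    \<comment> \<open>Expands row \<open>i\<close> in unit vectors and substitutes the
      \<open>u j\<close>; the coefficient -1 at \<open>i\<close> then gives a nontrivial relation
      among all the rows.\<close>
    define x where "x = (\<lambda>i'. \<Sum>j\<in>J. a i j * u j i')"
    have "matrix_image a (insert i I) (x(i := -1)) l = 0" if l: "l \<in> J" for l
    proof -
      have "matrix_image a I x l = (\<Sum>i'\<in>I. \<Sum>j\<in>J. a i j * (u j i' * a i' l))"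
        by (simp add: matrix_image_def x_def sum_distrib_right mult.assoc)
      also have "\<dots> = (\<Sum>j\<in>J. a i j * matrix_image a I (u j) l)"
        unfolding matrix_image_def sum_distrib_left by (rule sum.swap)
      also have "\<dots> = (\<Sum>j\<in>J. if j = l then a i l else 0)"
        using u l by (intro sum.cong refl) (metis mult_1_right mult_zero_left mult_zero_right unit_vec_def)
      also have "\<dots> = a i l" using l insert.prems(1) by simp
      finally show ?thesis by (simp add: split cong)
    qed
    from trivial_kernelD[OF insert.prems(2) this, where i = i] show False by simp
  qed
  then obtain j where j: "j \<in> J" "a i j \<noteq> 0" "trivial_kernel a I (J - {j})" by blast
  then obtain \<sigma> where \<sigma>: "inj_on \<sigma> I" "\<sigma> ` I \<subseteq> J - {j}" "\<forall>i\<in>I. a i (\<sigma> i) \<noteq> 0"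
    using insert.IH[of "J - {j}"] insert.prems(1) by auto
  have agree: "(\<sigma>(i := j)) i' = \<sigma> i'" if "i' \<in> I" for i'
    using that insert.hyps(2) by auto
  have im: "(\<sigma>(i := j)) ` I = \<sigma> ` I"
    using agree by (intro image_cong) auto
  have "inj_on (\<sigma>(i := j)) I"
    using \<sigma>(1) agree by (simp cong: inj_on_cong)
  hence "inj_on (\<sigma>(i := j)) (insert i I)"
    using \<sigma>(2) insert.hyps(2) im by (subst inj_on_insert) auto
  moreover have "(\<sigma>(i := j)) ` insert i I \<subseteq> J"
    using \<sigma>(2) j(1) im by auto
  moreover have "\<forall>i'\<in>insert i I. a i' ((\<sigma>(i := j)) i') \<noteq> 0"
    using \<sigma>(3) j(2) by auto
  ultimately show ?case by blast
qed

text \<open>A matching injects the rows into the columns.\<close>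

lemma trivial_kernel_card_le:
  assumes "finite I" "finite J" "trivial_kernel a I J"
  shows "card I \<le> card J"
  using trivial_kernel_imp_matching[OF assms] card_inj_on_le assms(2) by blast

text \<open>If \<open>y\<close> were not a combination of the rows, adjoining it as an extra row
  with index \<open>None\<close> would keep the rows independent, giving one more row than there are
  columns.\<close>

lemma trivial_kernel_imp_surj:
  assumes fin: "finite I" "finite J" and ker: "trivial_kernel (a :: 'i \<Rightarrow> 'j \<Rightarrow> 'k::field) I J"
    and card: "card I = card J"
  obtains x where "\<And>j. j \<in> J \<Longrightarrow> matrix_image a I x j = y j"
proof (rule ccontr)
  assume no: "\<not> thesis"
  define a' where "a' = (\<lambda>p. case p of None \<Rightarrow> y | Some i \<Rightarrow> a i)"
  let ?I = "insert None (Some ` I)"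
  have split: "matrix_image a' ?I x j = x None * y j + matrix_image a I (\<lambda>i. x (Some i)) j" for x j
    using fin by (simp add: matrix_image_def a'_def sum.reindex)
  have "trivial_kernel a' ?I J"
    unfolding trivial_kernel_def
  proof (intro allI impI)
    fix x assume x: "\<forall>j\<in>J. matrix_image a' ?I x j = 0"
    have 0: "x None = 0"
    proof (rule ccontr)
      assume nz: "x None \<noteq> 0"
      have "matrix_image a I (\<lambda>i. - x (Some i) / x None) j = y j" if "j \<in> J" for j
      proof -
        have "matrix_image a I (\<lambda>i. - x (Some i) / x None) j
            = - matrix_image a I (\<lambda>i. x (Some i)) j / x None"
          by (simp add: matrix_image_def sum_divide_distrib sum_negf)
        moreover have "matrix_image a I (\<lambda>i. x (Some i)) j = - (x None * y j)"
          using x that by (simp add: split eq_neg_iff_add_eq_0 add.commute)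
        ultimately show ?thesis using nz by simp
      qed
      thus False using no that by blast
    qed
    have "x (Some i) = 0" if "i \<in> I" for i
      using trivial_kernelD[OF ker, of "\<lambda>i. x (Some i)"] that x 0 by (simp add: split)
    with 0 show "\<forall>p\<in>?I. x p = 0" by auto
  qed
  hence "card ?I \<le> card J"
    using fin by (intro trivial_kernel_card_le) auto
  thus False using fin card by (simp add: card_image)
qed

section \<open>Linear maps preserving the commutation relation of a graph\<close>

text \<open>Vanishing of the 2x2 minors of the pair \<open>x\<close>, \<open>y\<close> at the edges,
  which are the coordinates of its wedge product in \<open>W\<close>.\<close>

definition commutes :: "('v \<times> 'v) set \<Rightarrow> ('v \<Rightarrow> 'k::field) \<Rightarrow> ('v \<Rightarrow> 'k) \<Rightarrow> bool" where
  "commutes E x y \<longleftrightarrow> (\<forall>i j. (i, j) \<in> E \<longrightarrow> x i * y j = x j * y i)"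

text \<open>The vicinal preorder of graph theory. The closed neighbourhood on the right makes it
  indifferent to whether \<open>j\<close> and \<open>k\<close> are adjacent.\<close>

definition dominates :: "('v \<times> 'v) set \<Rightarrow> 'v \<Rightarrow> 'v \<Rightarrow> bool" where
  "dominates E j k \<longleftrightarrow> E `` {k} \<subseteq> insert j (E `` {j})"

text \<open>The critical neighbour of \<open>k\<close> is \<open>l\<close> itself. Then
  \<open>k\<close> is a neighbour of \<open>l\<close>, hence equal or adjacent to \<open>m\<close>;
  if adjacent, \<open>m\<close> is a neighbour of \<open>k\<close> and so equal or adjacent to
  \<open>l\<close>.\<close>

lemma dominates_trans:
  assumes "sym E" "dominates E m l" "dominates E l k"
  shows "dominates E m k"
  using assms unfolding dominates_def sym_def by blast

text \<open>What a Lie isomorphism leaves on the vertices incident to an edge. Preservation runs one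
  way; the comparison of the graphs takes a second such map in the opposite direction.\<close>

locale commutation_map =
  fixes V :: "'v set" and W :: "'w set" and E F and a :: "'v \<Rightarrow> 'w \<Rightarrow> 'k::field"
  assumes finite: "finite V" "finite W"
    and E: "E \<subseteq> V \<times> V" "sym E" "irrefl E"
    and F: "F \<subseteq> W \<times> W" "sym F" "irrefl F"
    and kernel: "trivial_kernel a V W"
    and preserves: "\<And>x y. commutes E x y \<Longrightarrow>
      commutes F (matrix_image a V x) (matrix_image a V y)"
begin

text \<open>
  The vectors supported off the neighbours of \<open>i\<close> are the centralizer of \<open>e\<^sub>i\<close>, so they are mapped to
  the centralizer of \<open>a i\<close>. As \<open>a i j \<noteq> 0\<close>, a vector \<open>y\<close> of the latter satisfies
  \<open>y k = a i k / a i j * y j\<close> for the neighbours \<open>k\<close> of \<open>j\<close> and is determined by its other coordinates.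
\<close>

lemma centralizer_image:
  assumes i: "i \<in> V" and j: "a i j \<noteq> 0"
    and y: "y = matrix_image a (V - E `` {i}) x"
  shows "commutes F (a i) y" and "y j = 0 \<Longrightarrow> k \<in> F `` {j} \<Longrightarrow> y k = 0"
proof -
  let ?x = "\<lambda>l. if l \<in> V - E `` {i} then x l else 0"
  have "commutes E (unit_vec i) ?x"
    unfolding commutes_def
  proof (intro allI impI)
    fix p q assume "(p, q) \<in> E"
    moreover from this have "(q, p) \<in> E" by (rule symD[OF E(2)])
    ultimately show "unit_vec i p * ?x q = unit_vec i q * ?x p"
      by (auto simp: unit_vec_def)
  qed
  from preserves[OF this] show c: "commutes F (a i) y"
    using finite(1) i unfolding y by (subst (asm) matrix_image_restrict)
      (auto simp: matrix_image_unit_vec)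
  show "y k = 0" if "y j = 0" "k \<in> F `` {j}"
    using c that j unfolding commutes_def by (metis ImageE mult_eq_0_iff mult_zero_right singletonD)
qed

text \<open>A centralizer image vanishing outside the neighbours of \<open>j\<close> vanishes at
  \<open>j\<close>, as there are no loops, hence also at the neighbours of \<open>j\<close>, and
  independence of all the rows applies.\<close>

lemma centralizer_trivial_kernel:
  assumes i: "i \<in> V" and j: "j \<in> W" "a i j \<noteq> 0"
  shows "trivial_kernel a (V - E `` {i}) (W - F `` {j})"
  unfolding trivial_kernel_def
proof (intro allI impI)
  fix x assume x: "\<forall>j\<in>W - F `` {j}. matrix_image a (V - E `` {i}) x j = 0"
  have "j \<notin> F `` {j}" using F by (auto simp: irrefl_def)
  hence 0: "matrix_image a (V - E `` {i}) x k = 0" if "k \<in> W" for k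
    using x that j centralizer_image(2)[OF i j(2) refl] by blast
  let ?x = "\<lambda>l. if l \<in> V - E `` {i} then x l else 0"
  have "?x l = 0" if "l \<in> V" for l
    using trivial_kernelD[OF kernel _ that, of ?x] 0 finite by (subst (asm) matrix_image_restrict) auto
  thus "\<forall>l\<in>V - E `` {i}. x l = 0" by (metis DiffD1)
qed

lemma degree_le:
  assumes i: "i \<in> V" and j: "j \<in> W" "a i j \<noteq> 0" and card: "card V = card W"
  shows "card (F `` {j}) \<le> card (E `` {i})"
proof -
  have sub: "E `` {i} \<subseteq> V" "F `` {j} \<subseteq> W" using E F by auto
  have "card (V - E `` {i}) \<le> card (W - F `` {j})"
    using finite centralizer_trivial_kernel[OF i j] by (intro trivial_kernel_card_le) auto
  \<comment> \<open>Guards against truncation in the subtraction of naturals above.\<close>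
  moreover have "card (F `` {j}) \<le> card W"
    using sub finite by (simp add: card_mono)
  ultimately show ?thesis
    using sub finite card by (simp add: card_Diff_subset finite_subset)
qed

lemma degree_eq_imp_dominates:
  assumes i: "i \<in> V" and j: "j \<in> W" "a i j \<noteq> 0" and card: "card V = card W"
    and deg: "card (F `` {j}) = card (E `` {i})" and k: "a i k \<noteq> 0"
  shows "dominates F j k"
  unfolding dominates_def
proof (rule subsetI, rule ccontr)
  fix l assume "l \<in> F `` {k}" and l: "l \<notin> insert j (F `` {j})"
  hence kl: "(k, l) \<in> F" "l \<in> W" "k \<in> W" "k \<noteq> l" using F by (auto simp: irrefl_def)
  have "card (V - E `` {i}) = card (W - F `` {j})"
    using E F finite card deg by (subst (1 2) card_Diff_subset) (auto intro: finite_subset)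
  then obtain x where
    x: "\<And>p. p \<in> W - F `` {j} \<Longrightarrow> matrix_image a (V - E `` {i}) x p = unit_vec l p"
    using trivial_kernel_imp_surj[OF _ _ centralizer_trivial_kernel[OF i j]] finite by blast
  let ?y = "matrix_image a (V - E `` {i}) x"
  have "j \<notin> F `` {j}" using F by (auto simp: irrefl_def)
  hence "?y j = 0" using x j l by (auto simp: unit_vec_def)
  hence "?y k = 0"
    using x[of k] kl centralizer_image(2)[OF i j(2) refl] by (cases "k \<in> F `` {j}") (auto simp: unit_vec_def)
  moreover have "?y l = 1" using x[of l] kl l by (auto simp: unit_vec_def)
  ultimately show False
    using centralizer_image(1)[OF i j(2) refl, of x, unfolded commutes_def, rule_format, OF kl(1)] k
    by simp
qed

text \<open>
  If \<open>\<sigma> i\<close> and \<open>\<sigma> j\<close> were adjacent, the 2x2 minor at these indices would vanish, so \<open>\<sigma> i\<close> and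
  \<open>\<sigma> j\<close> would dominate each other and a combination of the rows \<open>i\<close> and \<open>j\<close> would be supported on the
  indices strictly below \<open>\<sigma> i\<close>. The rows matched with those indices span all such vectors already.
\<close>

lemma nonadjacent_matching:
  assumes \<sigma>: "bij_betw \<sigma> V W" "\<And>i. i \<in> V \<Longrightarrow> a i (\<sigma> i) \<noteq> 0"
    and dom: "\<And>i k. \<lbrakk>i \<in> V; k \<in> W; a i k \<noteq> 0\<rbrakk> \<Longrightarrow> dominates F (\<sigma> i) k"
    and ij: "i \<in> V" "j \<in> V" "(\<sigma> i, \<sigma> j) \<in> F"
  shows "(i, j) \<in> E"
proof (rule ccontr)
  assume nonadj: "(i, j) \<notin> E"
  have "i \<noteq> j" using F ij by (auto simp: irrefl_def)
  have \<sigma>W: "\<sigma> l \<in> W" if "l \<in> V" for l using \<sigma>(1) that by (auto simp: bij_betw_def)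
  have "commutes E (unit_vec i) (unit_vec j :: _ \<Rightarrow> 'k)"
    using nonadj symD[OF E(2), of j i] by (auto simp: commutes_def unit_vec_def)
  from preserves[OF this] have minor: "a i k * a j l = a i l * a j k" if "(k, l) \<in> F" for k l
    using that ij(1,2) finite(1) unfolding commutes_def
    by (simp only: matrix_image_unit_vec) metis
  have "a i (\<sigma> j) \<noteq> 0" "a j (\<sigma> i) \<noteq> 0"
    using minor[OF ij(3)] \<sigma>(2)[OF ij(1)] \<sigma>(2)[OF ij(2)] by auto
  hence ij_dom: "dominates F (\<sigma> i) (\<sigma> j)" "dominates F (\<sigma> j) (\<sigma> i)"
    using dom ij \<sigma>W by auto
  define D where "D = {k \<in> W. dominates F (\<sigma> i) k \<and> \<not> dominates F k (\<sigma> i)}"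
  \<comment> \<open>Cancels the entry at \<open>\<sigma> i\<close>; since the minors vanish along
    edges, the entries at the neighbours of \<open>\<sigma> i\<close> are cancelled as well.\<close>
  define c where "c = a j (\<sigma> i) / a i (\<sigma> i)"
  define y where "y = (\<lambda>k. a j k - c * a i k)"
  have y0: "y k = 0" if k: "k \<in> W - D" for k
  proof (cases "dominates F (\<sigma> i) k")
    case False
    hence "\<not> dominates F (\<sigma> j) k" using dominates_trans[OF F(2) ij_dom(1)] by blast
    with False have "a i k = 0" "a j k = 0" using dom[of _ k] ij k by blast+
    thus ?thesis by (simp add: y_def)
  next
    case True
    hence "dominates F k (\<sigma> i)" using k by (auto simp: D_def)
    \<comment> \<open>As a neighbour of \<open>\<sigma> i\<close>, the vertex
      \<open>\<sigma> j\<close> is equal or adjacent to \<open>k\<close>. In the second case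
      \<open>k\<close> is a neighbour of \<open>\<sigma> j\<close>, hence in the closed
      neighbourhood of \<open>\<sigma> i\<close>.\<close>
    hence "k = \<sigma> i \<or> (k, \<sigma> i) \<in> F"
      using True ij(3) ij_dom(1) F(2) unfolding dominates_def sym_def by blast
    thus ?thesis
    proof
      assume "k = \<sigma> i"
      thus ?thesis using \<sigma>(2)[OF ij(1)] by (simp add: y_def c_def)
    next
      assume "(k, \<sigma> i) \<in> F"
      from minor[OF this] show ?thesis
        using \<sigma>(2)[OF ij(1)] by (simp add: y_def c_def field_simps)
    qed
  qed
  define I where "I = {l \<in> V. \<sigma> l \<in> D}"
  have bij: "bij_betw \<sigma> I D"
    unfolding I_def using \<sigma>(1) by (auto simp: bij_betw_def D_def intro: inj_on_subset)
  have fin: "finite I" "finite D" using finite by (auto simp: I_def D_def)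
  \<comment> \<open>\<open>D\<close> is closed downwards under domination, so rows matched with
    elements of \<open>D\<close> are supported on \<open>D\<close>.\<close>
  have off: "matrix_image a I x k = 0" if k: "k \<in> W - D" for x k
  proof -
    have "a l k = 0" if "l \<in> I" for l
    proof (rule ccontr)
      assume "a l k \<noteq> 0"
      hence "dominates F (\<sigma> l) k" using dom that k by (auto simp: I_def)
      hence "k \<in> D"
        using that k dominates_trans[OF F(2)] unfolding I_def D_def by blast
      thus False using k by simp
    qed
    thus ?thesis by (simp add: matrix_image_def)
  qed
  have restrict: "matrix_image a V (\<lambda>l. if l \<in> I then x l else 0) = matrix_image a I x" for x
    using finite by (intro matrix_image_restrict) (auto simp: I_def)
  have "trivial_kernel a I D"
    unfolding trivial_kernel_def
  proof (intro allI impI ballI)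
    fix x l assume x: "\<forall>k\<in>D. matrix_image a I x k = 0" and l: "l \<in> I"
    have "matrix_image a V (\<lambda>l. if l \<in> I then x l else 0) k = 0" if "k \<in> W" for k
      using off x that by (cases "k \<in> D") (auto simp: restrict)
    from trivial_kernelD[OF kernel this, of l] show "x l = 0"
      using l by (auto simp: I_def)
  qed
  then obtain x where x: "\<And>k. k \<in> D \<Longrightarrow> matrix_image a I x k = y k"
    using trivial_kernel_imp_surj[OF fin _ bij_betw_same_card[OF bij]] by blast
  \<comment> \<open>A relation among all the rows whose coefficient at \<open>j\<close> is 1 unless
    \<open>j \<in> I\<close>; but \<open>j \<in> I\<close> would put \<open>\<sigma> j\<close>
    strictly below \<open>\<sigma> i\<close>.\<close>
  let ?z = "\<lambda>l. unit_vec j l - c * unit_vec i l - (if l \<in> I then x l else 0)"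
  have "matrix_image a V ?z = (\<lambda>k. matrix_image a V (unit_vec j) k
      - c * matrix_image a V (unit_vec i) k - matrix_image a V (\<lambda>l. if l \<in> I then x l else 0) k)"
    unfolding matrix_image_def sum_distrib_left sum_subtractf[symmetric]
    by (simp add: left_diff_distrib mult.assoc)
  also have "\<dots> = (\<lambda>k. y k - matrix_image a I x k)"
    using finite ij by (simp add: restrict matrix_image_unit_vec y_def)
  finally have "matrix_image a V ?z k = 0" if "k \<in> W" for k
    using x y0 off that by (cases "k \<in> D") auto
  from trivial_kernelD[OF kernel this ij(2)] have "j \<in> I"
    using \<open>i \<noteq> j\<close> by (auto simp: unit_vec_def split: if_splits)
  thus False using ij_dom by (auto simp: I_def D_def)
qed

end

text \<open>Degrees do not increase along either matching, so comparing degree sums gives equality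
  at each vertex. Then \<open>\<sigma>\<close> reflects edges, and counting neighbours shows that it
  preserves them.\<close>

lemma commutation_maps_imp_graph_iso:
  assumes ab: "commutation_map V W E F (a :: 'v \<Rightarrow> 'w \<Rightarrow> 'k::field)" "commutation_map W V F E b"
  obtains \<sigma> where "bij_betw \<sigma> V W"
    "\<And>i j. \<lbrakk>i \<in> V; j \<in> V\<rbrakk> \<Longrightarrow> (i, j) \<in> E \<longleftrightarrow> (\<sigma> i, \<sigma> j) \<in> F"
proof -
  interpret A: commutation_map V W E F a by fact
  interpret B: commutation_map W V F E b by fact
  let ?d = "\<lambda>i. card (E `` {i})" and ?e = "\<lambda>j. card (F `` {j})"
  have card: "card V = card W"
    using trivial_kernel_card_le[OF _ _ A.kernel] trivial_kernel_card_le[OF _ _ B.kernel] A.finite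
    by (simp add: le_antisym)
  obtain \<sigma> where \<sigma>: "inj_on \<sigma> V" "\<sigma> ` V \<subseteq> W" "\<And>i. i \<in> V \<Longrightarrow> a i (\<sigma> i) \<noteq> 0"
    using trivial_kernel_imp_matching[OF A.finite A.kernel] by blast
  obtain \<tau> where \<tau>: "inj_on \<tau> W" "\<tau> ` W \<subseteq> V" "\<And>i. i \<in> W \<Longrightarrow> b i (\<tau> i) \<noteq> 0"
    using trivial_kernel_imp_matching[OF B.finite B.kernel] by blast
  have bij: "bij_betw \<sigma> V W" "bij_betw \<tau> W V"
    using \<sigma> \<tau> A.finite card unfolding bij_betw_def by (simp_all add: card_image card_subset_eq)
  have le: "?e (\<sigma> i) \<le> ?d i" if "i \<in> V" for i
    using that \<sigma> card by (intro A.degree_le) auto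
  \<comment> \<open>The second matching \<open>\<tau>\<close> only serves to bound the degree sum of
    \<open>E\<close> by that of \<open>F\<close>.\<close>
  have "sum ?d V = (\<Sum>j\<in>W. ?d (\<tau> j))"
    using sum.reindex_bij_betw[OF bij(2), of ?d] by simp
  also have "\<dots> \<le> sum ?e W"
    using \<tau> card by (intro sum_mono B.degree_le) auto
  also have "\<dots> = (\<Sum>i\<in>V. ?e (\<sigma> i))"
    using sum.reindex_bij_betw[OF bij(1), of ?e] by simp
  finally have sum: "sum ?d V \<le> (\<Sum>i\<in>V. ?e (\<sigma> i))" .
  have deg: "?e (\<sigma> i) = ?d i" if i: "i \<in> V" for i
  proof (rule ccontr)
    assume "?e (\<sigma> i) \<noteq> ?d i"
    hence "(\<Sum>i\<in>V. ?e (\<sigma> i)) < sum ?d V"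
      using le i A.finite by (intro sum_strict_mono_ex1) (auto simp: order.strict_iff_order)
    with sum show False by simp
  qed
  have adj: "(i, j) \<in> E" if "i \<in> V" "j \<in> V" "(\<sigma> i, \<sigma> j) \<in> F" for i j
    using bij(1) \<sigma>(3) _ that
  proof (rule A.nonadjacent_matching)
    show "dominates F (\<sigma> i) k" if "i \<in> V" "k \<in> W" "a i k \<noteq> 0" for i k
      using that \<sigma> card deg by (intro A.degree_eq_imp_dominates[of i]) auto
  qed
  have nb: "\<sigma> ` (E `` {i}) = F `` {\<sigma> i}" if i: "i \<in> V" for i
  proof (rule card_seteq[symmetric])
    have EV: "E `` {i} \<subseteq> V" using A.E by auto
    thus "finite (\<sigma> ` (E `` {i}))" using A.finite finite_subset by blast
    show "F `` {\<sigma> i} \<subseteq> \<sigma> ` (E `` {i})"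
    proof
      fix q assume q: "q \<in> F `` {\<sigma> i}"
      then obtain j where "j \<in> V" "q = \<sigma> j"
        using A.F bij(1) by (auto simp: bij_betw_def)
      thus "q \<in> \<sigma> ` (E `` {i})" using adj i q by auto
    qed
    show "card (\<sigma> ` (E `` {i})) \<le> card (F `` {\<sigma> i})"
      using deg[OF i] card_image_le[of "E `` {i}" \<sigma>] EV A.finite finite_subset by metis
  qed
  show thesis
    using that[OF bij(1)] adj nb by blast
qed

section \<open>Invariant parts of a Lie algebra\<close>

text \<open>Expressed by the bracket alone, hence invariant. In a graph Lie algebra, if
  \<open>x\<close> acts with zero weights, \<open>ad x\<close> maps everything to
  \<open>V + W\<close>, then to \<open>W\<close>, then to zero.\<close>

definition ad3_zero :: "('k, 'a::ab_group_add) lie_struct \<Rightarrow> 'a set" where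
  "ad3_zero L = {x \<in> lie_carrier L. \<forall>y \<in> lie_carrier L.
     lie_bracket L x (lie_bracket L x (lie_bracket L x y)) = 0}"

definition ad3_zero_center :: "('k, 'a::ab_group_add) lie_struct \<Rightarrow> 'a set" where
  "ad3_zero_center L = {x \<in> ad3_zero L. \<forall>y \<in> ad3_zero L. lie_bracket L x y = 0}"

context lie_algebra
begin

lemma carrier_zero: "0 \<in> lie_carrier L"
  and carrier_add: "\<lbrakk>x \<in> lie_carrier L; y \<in> lie_carrier L\<rbrakk> \<Longrightarrow> x + y \<in> lie_carrier L"
  and carrier_scale: "x \<in> lie_carrier L \<Longrightarrow> lie_scale L c x \<in> lie_carrier L"
proof -
  interpret vector_space "lie_scale L" by (rule vector_space)
  show "0 \<in> lie_carrier L"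
    "\<lbrakk>x \<in> lie_carrier L; y \<in> lie_carrier L\<rbrakk> \<Longrightarrow> x + y \<in> lie_carrier L"
    "x \<in> lie_carrier L \<Longrightarrow> lie_scale L c x \<in> lie_carrier L"
    using subspace by (simp_all add: subspace_0 subspace_add subspace_scale)
qed

lemma carrier_sum:
  "(\<And>i. i \<in> I \<Longrightarrow> v i \<in> lie_carrier L) \<Longrightarrow> (\<Sum>i\<in>I. v i) \<in> lie_carrier L"
  by (induction I rule: infinite_finite_induct) (auto intro: carrier_zero carrier_add)

end

locale lie_iso = L: lie_algebra L + M: lie_algebra M
  for L :: "('k::field, 'a::ab_group_add) lie_struct"
    and M :: "('k, 'b::ab_group_add) lie_struct" +
  fixes \<phi> :: "'a \<Rightarrow> 'b"
  assumes iso: "lie_isomorphism L M \<phi>"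
begin

lemma bij: "bij_betw \<phi> (lie_carrier L) (lie_carrier M)"
  and add: "\<lbrakk>x \<in> lie_carrier L; y \<in> lie_carrier L\<rbrakk> \<Longrightarrow> \<phi> (x + y) = \<phi> x + \<phi> y"
  and scale: "x \<in> lie_carrier L \<Longrightarrow> \<phi> (lie_scale L c x) = lie_scale M c (\<phi> x)"
  and bracket: "\<lbrakk>x \<in> lie_carrier L; y \<in> lie_carrier L\<rbrakk> \<Longrightarrow>
    \<phi> (lie_bracket L x y) = lie_bracket M (\<phi> x) (\<phi> y)"
  using iso unfolding lie_isomorphism_def by blast+

lemma image: "\<phi> ` lie_carrier L = lie_carrier M"
  using bij by (simp add: bij_betw_def)

lemma closed: "x \<in> lie_carrier L \<Longrightarrow> \<phi> x \<in> lie_carrier M"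
  using image by blast

lemma zero: "\<phi> 0 = 0"
  using add[OF L.carrier_zero L.carrier_zero] by simp

lemma eq_zero_iff: "x \<in> lie_carrier L \<Longrightarrow> \<phi> x = 0 \<longleftrightarrow> x = 0"
  using bij L.carrier_zero zero unfolding bij_betw_def inj_on_def by metis

lemma sum:
  "(\<And>i. i \<in> I \<Longrightarrow> v i \<in> lie_carrier L) \<Longrightarrow> \<phi> (\<Sum>i\<in>I. v i) = (\<Sum>i\<in>I. \<phi> (v i))"
  by (induction I rule: infinite_finite_induct) (auto simp: zero add L.carrier_sum)

lemma ad3_zero_iff: "x \<in> lie_carrier L \<Longrightarrow> \<phi> x \<in> ad3_zero M \<longleftrightarrow> x \<in> ad3_zero L"
  by (auto simp: ad3_zero_def image[symmetric] bracket[symmetric] L.bracket_closed eq_zero_iff)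

lemma image_ad3_zero: "\<phi> ` ad3_zero L = ad3_zero M"
proof
  show "\<phi> ` ad3_zero L \<subseteq> ad3_zero M"
    using ad3_zero_iff by (auto simp: ad3_zero_def)
  show "ad3_zero M \<subseteq> \<phi> ` ad3_zero L"
  proof
    fix y assume y: "y \<in> ad3_zero M"
    then obtain x where "x \<in> lie_carrier L" "y = \<phi> x"
      using image by (auto simp: ad3_zero_def)
    thus "y \<in> \<phi> ` ad3_zero L" using y ad3_zero_iff by blast
  qed
qed

lemma ad3_zero_center_iff:
  assumes x: "x \<in> lie_carrier L"
  shows "\<phi> x \<in> ad3_zero_center M \<longleftrightarrow> x \<in> ad3_zero_center L"
proof -
  have "lie_bracket M (\<phi> x) (\<phi> y) = 0 \<longleftrightarrow> lie_bracket L x y = 0" if "y \<in> ad3_zero L" for y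
    using that x by (simp add: ad3_zero_def bracket[symmetric] L.bracket_closed eq_zero_iff)
  thus ?thesis
    using ad3_zero_iff[OF x] unfolding ad3_zero_center_def mem_Collect_eq
    by (simp only: image_ad3_zero[symmetric] ball_simps(9) cong: ball_cong)
qed

lemma inverse: "lie_isomorphism M L (inv_into (lie_carrier L) \<phi>)"
proof -
  let ?\<psi> = "inv_into (lie_carrier L) \<phi>"
  have \<psi>: "?\<psi> x \<in> lie_carrier L" "\<phi> (?\<psi> x) = x" if "x \<in> lie_carrier M" for x
    using that by (auto simp: image[symmetric] inv_into_into f_inv_into_f)
  have eqI: "?\<psi> x = y" if "y \<in> lie_carrier L" "\<phi> y = x" for x y
    using that bij by (auto simp: bij_betw_def)
  show ?thesis
    unfolding lie_isomorphism_def
    using bij_betw_inv_into[OF bij]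
    by (auto intro!: eqI simp: \<psi> add scale bracket L.carrier_add L.carrier_scale L.bracket_closed)
qed

end

section \<open>The bracket of a graph Lie algebra in coordinates\<close>

lemma graph_lie_algebra_simps [simp]:
  "lie_carrier (graph_lie_algebra G) = {x. \<forall>b. b \<notin> graph_basis G \<longrightarrow> x b = 0}"
  "lie_scale (graph_lie_algebra G) = scale_fun"
  "lie_bracket (graph_lie_algebra G) = graph_bracket G"
  by (simp_all add: graph_lie_algebra_def)

fun clique_mem :: "'v basis_index \<Rightarrow> 'v \<Rightarrow> 'k::field" where
  "clique_mem (Clique i j k) a = (if a \<in> {i, j, k} then 1 else 0)"
| "clique_mem _ a = 0"

text \<open>The coordinate of \<open>[e_a, x]\<close> at \<open>Vert a\<close>. On a wedge the
  cliques act by the sum of the weights of its two ends, which unites the factors 2, 1 and 0 of the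
  bracket.\<close>

definition weight :: "'v::linorder pair_pre_digraph \<Rightarrow> ('v basis_index \<Rightarrow> 'k::field) \<Rightarrow> 'v \<Rightarrow> 'k" where
  "weight G x a = (\<Sum>p\<in>graph_basis G. x p * clique_mem p a)"

lemma pair_graph_sym: "pair_graph G \<Longrightarrow> sym (parcs G)"
  using pair_sym_digraph.pair_sym_arcs[of G]
  by (simp add: pair_graph_def pair_pseudo_graph_def symmetric_def)

text \<open>The case table becomes a difference of conditionals that each fix one argument, the form
  in which \<open>sum_pick_left\<close> and \<open>sum_pick_right\<close> evaluate the double
  sum.\<close>

lemma basis_bracket_Vert:
  "(basis_bracket G p q (Vert a) :: 'k::field) =
    (if p = Vert a then clique_mem q a else 0) - (if q = Vert a then clique_mem p a else 0)"
  by (cases p; cases q) (auto simp: wedge_vec_def unit_vec_def scale_fun_def)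

lemma basis_bracket_Clique: "basis_bracket G p q (Clique i j k) = 0"
  by (cases p; cases q) (auto simp: wedge_vec_def unit_vec_def scale_fun_def)

lemma wedge_vec_Wedge:
  assumes "a < b"
  shows "(wedge_vec i j (Wedge a b) :: 'k::field) =
    (if i = a then if j = b then 1 else 0 else 0) - (if i = b then if j = a then 1 else 0 else 0)"
proof -
  have ne: "a \<noteq> b" "\<not> b < a" using assms by auto
  consider "i = a" "j = b" | "i = b" "j = a" | "\<not> (i = a \<and> j = b)" "\<not> (i = b \<and> j = a)"
    by blast
  thus ?thesis
  proof cases
    case 1
    with ne assms show ?thesis by (simp add: wedge_vec_def unit_vec_def)
  next
    case 2
    with ne assms show ?thesis by (simp add: wedge_vec_def unit_vec_def)
  next
    case 3
    thus ?thesis by (simp add: wedge_vec_def unit_vec_def)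
  qed
qed

lemma basis_bracket_Wedge_Clique:
  fixes G :: "'v::linorder pair_pre_digraph"
  shows "basis_bracket G (Wedge a b) (Clique i j k) = scale_fun
      (clique_mem (Clique i j k) a + clique_mem (Clique i j k) b :: 'k::field) (unit_vec (Wedge a b))"
    and "basis_bracket G (Clique i j k) (Wedge a b) = scale_fun
      (- (clique_mem (Clique i j k) a + clique_mem (Clique i j k) b :: 'k)) (unit_vec (Wedge a b))"
  by (cases "a \<in> {i, j, k}"; cases "b \<in> {i, j, k}"; simp add: scale_fun_def fun_eq_iff)+

lemma basis_bracket_Wedge:
  assumes "pair_graph G" "a < b" "(a, b) \<in> parcs G"
  shows "(basis_bracket G p q (Wedge a b) :: 'k::field) =
    (if p = Vert a then if q = Vert b then 1 else 0 else 0)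
    - (if p = Vert b then if q = Vert a then 1 else 0 else 0)
    + (if p = Wedge a b then clique_mem q a + clique_mem q b else 0)
    - (if q = Wedge a b then clique_mem p a + clique_mem p b else 0)"
proof (cases "\<exists>i j. p = Vert i \<and> q = Vert j")
  case True
  then obtain i j where pq: "p = Vert i" "q = Vert j" by blast
  have "(b, a) \<in> parcs G" by (rule symD[OF pair_graph_sym[OF assms(1)] assms(3)])
  \<comment> \<open>As \<open>a\<close> and \<open>b\<close> are adjacent, the edge test in the
    bracket can fail only for other pairs, where both sides vanish.\<close>
  hence "(i, j) \<in> parcs G \<or> \<not> (i = a \<and> j = b) \<and> \<not> (i = b \<and> j = a)"
    using assms(3) by blast
  thus ?thesis
    by (elim disjE) (simp_all add: pq wedge_vec_Wedge[OF assms(2)])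
next
  case False
  note [simp del] = basis_bracket.simps(3,5) clique_mem.simps(1)
  show ?thesis
    using False
    by (cases p; cases q; simp add: unit_vec_def scale_fun_def basis_bracket_Wedge_Clique)
qed

lemma sum_pick_left:
  fixes x y :: "'b \<Rightarrow> 'k::field"
  assumes "finite B" "c \<in> B"
  shows "(\<Sum>p\<in>B. \<Sum>q\<in>B. x p * y q * (if p = c then f q else 0)) = x c * (\<Sum>q\<in>B. y q * f q)"
proof -
  have "(\<Sum>p\<in>B. \<Sum>q\<in>B. x p * y q * (if p = c then f q else 0))
      = (\<Sum>p\<in>B. if p = c then x c * (\<Sum>q\<in>B. y q * f q) else 0)"
    by (intro sum.cong) (auto simp: sum_distrib_left mult.assoc)
  thus ?thesis using assms by simp
qed

lemma sum_pick_right: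
  fixes x y :: "'b \<Rightarrow> 'k::field"
  assumes "finite B" "c \<in> B"
  shows "(\<Sum>p\<in>B. \<Sum>q\<in>B. x p * y q * (if q = c then f p else 0)) = y c * (\<Sum>p\<in>B. x p * f p)"
proof -
  have "(\<Sum>p\<in>B. \<Sum>q\<in>B. x p * y q * (if q = c then f p else 0))
      = (\<Sum>p\<in>B. \<Sum>q\<in>B. y p * x q * (if p = c then f q else 0))"
    by (subst sum.swap) (intro sum.cong refl, simp)
  thus ?thesis using sum_pick_left[OF assms, of y x f] by simp
qed

lemma sum_pick:
  fixes y :: "'b \<Rightarrow> 'k::field"
  assumes "finite B" "c \<in> B"
  shows "(\<Sum>q\<in>B. y q * (if q = c then 1 else 0)) = y c"
  using assms by (simp add: if_distrib[of "\<lambda>t. _ * t"] cong: if_cong)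

lemma graph_bracket_Vert:
  assumes "pair_graph G" "a \<in> pverts G"
  shows "graph_bracket G x y (Vert a) = x (Vert a) * weight G y a - y (Vert a) * weight G x a"
  using sum_pick_left[of "graph_basis G" "Vert a" x y "\<lambda>q. clique_mem q a"]
    sum_pick_right[of "graph_basis G" "Vert a" x y "\<lambda>q. clique_mem q a"]
    finite_graph_basis[OF assms(1)] assms(2)
  by (simp add: graph_bracket_apply basis_bracket_Vert right_diff_distrib sum_subtractf weight_def)

lemma graph_bracket_Clique: "graph_bracket G x y (Clique i j k) = 0"
  by (simp add: graph_bracket_apply basis_bracket_Clique)

lemma graph_bracket_Wedge:
  assumes "pair_graph G" "a < b" "(a, b) \<in> parcs G"
  shows "graph_bracket G x y (Wedge a b) = x (Vert a) * y (Vert b) - x (Vert b) * y (Vert a)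
    + x (Wedge a b) * (weight G y a + weight G y b) - y (Wedge a b) * (weight G x a + weight G x b)"
proof -
  let ?B = "graph_basis G"
  have fin: "finite ?B" by (rule finite_graph_basis[OF assms(1)])
  interpret pair_graph G by fact
  have in_B: "Vert a \<in> ?B" "Vert b \<in> ?B" "Wedge a b \<in> ?B"
    using assms in_arcsD1 in_arcsD2 by auto
  have w: "(\<Sum>q\<in>?B. z q * (clique_mem q a + clique_mem q b)) = weight G z a + weight G z b"
    for z :: "'a basis_index \<Rightarrow> 'b"
    by (simp add: weight_def distrib_left sum.distrib)
  show ?thesis
    unfolding graph_bracket_apply basis_bracket_Wedge[OF assms] right_diff_distrib
      distrib_left[of "_ * _"] sum_subtractf sum.distrib
      sum_pick_left[OF fin in_B(1)] sum_pick_left[OF fin in_B(2)] sum_pick_left[OF fin in_B(3)]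
      sum_pick_right[OF fin in_B(3)] sum_pick[OF fin in_B(1)] sum_pick[OF fin in_B(2)] w ..
qed

lemma graph_bracket_outside:
  assumes "pair_graph G" "b \<notin> graph_basis G"
  shows "graph_bracket G x y b = 0"
  by (simp add: graph_bracket_apply basis_bracket_support[OF assms(1) _ _ assms(2)])

section \<open>The invariant subsets of a graph Lie algebra\<close>

lemma weight_no_cliques: "(\<And>i j k. x (Clique i j k) = 0) \<Longrightarrow> weight G x a = 0"
  unfolding weight_def by (intro sum.neutral ballI) (metis clique_mem.elims mult_zero_left mult_zero_right)

lemma weight_graph_bracket [simp]: "weight G (graph_bracket G x y) a = 0"
  by (rule weight_no_cliques) (rule graph_bracket_Clique)

text \<open>Applying \<open>ad x\<close> three times to \<open>e_a\<close> leaves minus the cube of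
  the weight at \<open>Vert a\<close>. Conversely, with zero weights the first bracket has no clique
  coordinates, the second no vertex coordinates and the third no wedge coordinates.\<close>

lemma ad3_zero_graph:
  assumes G: "pair_graph G"
  shows "ad3_zero (graph_lie_algebra G :: ('k::field, _) lie_struct) =
    {x. (\<forall>b. b \<notin> graph_basis G \<longrightarrow> x b = 0) \<and> (\<forall>a\<in>pverts G. weight G x a = 0)}"
    (is "?L = ?R")
proof (intro equalityI subsetI)
  let ?br = "graph_bracket G :: (_ \<Rightarrow> 'k) \<Rightarrow> _"
  interpret pair_graph G by fact
  fix x :: "_ \<Rightarrow> 'k"
  {
    assume x: "x \<in> ?L"
    have "weight G x a = 0" if a: "a \<in> pverts G" for a
    proof -
      let ?e = "unit_vec (Vert a) :: _ \<Rightarrow> 'k"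
      have "?br x (?br x (?br x ?e)) = 0"
        using x a by (auto simp: ad3_zero_def unit_vec_def)
      hence "?br x (?br x (?br x ?e)) (Vert a) = 0" by simp
      moreover have "weight G ?e a = 0" by (rule weight_no_cliques) (simp add: unit_vec_def)
      ultimately show ?thesis
        using a by (simp add: graph_bracket_Vert[OF G] unit_vec_def)
    qed
    thus "x \<in> ?R" using x by (auto simp: ad3_zero_def)
  next
    assume x: "x \<in> ?R"
    have "?br x (?br x (?br x y)) b = 0" for y b
    proof (cases "b \<in> graph_basis G")
      case b: True
      show ?thesis
      proof (cases b)
        case (Vert a)
        thus ?thesis using x b by (simp add: graph_bracket_Vert[OF G])
      next
        case (Wedge i j)
        hence ij: "i < j" "(i, j) \<in> parcs G" using b by simp_all
        hence "i \<in> pverts G" "j \<in> pverts G" using in_arcsD1 in_arcsD2 by blast+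
        thus ?thesis
          using x by (simp add: Wedge graph_bracket_Vert[OF G] graph_bracket_Wedge[OF G ij])
      qed (simp add: graph_bracket_Clique)
    qed (simp add: graph_bracket_outside[OF G])
    thus "x \<in> ?L" using x by (auto simp: ad3_zero_def fun_eq_iff)
  }
qed

text \<open>With zero weights only the wedge coordinates survive, and these are the 2x2
  minors.\<close>

lemma graph_bracket_eq_0_iff:
  fixes x y :: "_ \<Rightarrow> 'k::field"
  assumes G: "pair_graph G"
    and x: "x \<in> ad3_zero (graph_lie_algebra G)" and y: "y \<in> ad3_zero (graph_lie_algebra G)"
  shows "graph_bracket G x y = 0 \<longleftrightarrow> commutes (parcs G) (\<lambda>i. x (Vert i)) (\<lambda>i. y (Vert i))"
    (is "?L \<longleftrightarrow> ?R")
proof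
  interpret pair_graph G by fact
  have w: "weight G x a = 0" "weight G y a = 0" if "a \<in> pverts G" for a
    using x y that by (simp_all add: ad3_zero_graph[OF G])
  have wedge: "graph_bracket G x y (Wedge i j) = x (Vert i) * y (Vert j) - x (Vert j) * y (Vert i)"
    if "i < j" "(i, j) \<in> parcs G" for i j
    using that w[OF in_arcsD1[OF that(2)]] w[OF in_arcsD2[OF that(2)]]
    by (simp add: graph_bracket_Wedge[OF G])
  {
    assume L: ?L
    show ?R
      unfolding commutes_def
    proof (intro allI impI)
      fix i j assume ij: "(i, j) \<in> parcs G"
      hence ji: "(j, i) \<in> parcs G" and "i \<noteq> j"
        using symD[OF pair_graph_sym[OF G] ij] pair_no_loops[OF ij] by simp_all
      then consider "i < j" | "j < i" by fastforce
      thus "x (Vert i) * y (Vert j) = x (Vert j) * y (Vert i)"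
        using wedge[of i j] wedge[of j i] ij ji L by cases simp_all
    qed
  next
    assume R: ?R
    show ?L
    proof
      fix b
      show "graph_bracket G x y b = 0 b"
      proof (cases "b \<in> graph_basis G")
        case b: True
        show ?thesis
        proof (cases b)
          case (Vert a)
          thus ?thesis using w b by (simp add: graph_bracket_Vert[OF G])
        next
          case (Wedge i j)
          hence ij: "i < j" "(i, j) \<in> parcs G" using b by simp_all
          hence "x (Vert i) * y (Vert j) = x (Vert j) * y (Vert i)"
            using R unfolding commutes_def by blast
          thus ?thesis using wedge[OF ij] Wedge by simp
        qed (simp add: graph_bracket_Clique)
      qed (simp add: graph_bracket_outside[OF G])
    qed
  }
qed

text \<open>Representatives of \<open>ad3_zero\<close> modulo its center; isolated vertices are cut
  off because they are central there.\<close>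

definition vert_vec :: "'v::linorder pair_pre_digraph \<Rightarrow> ('v \<Rightarrow> 'k::field) \<Rightarrow> 'v basis_index \<Rightarrow> 'k" where
  "vert_vec G x p = (case p of Vert i \<Rightarrow> if i \<in> Domain (parcs G) then x i else 0 | _ \<Rightarrow> 0)"

lemma vert_vec_simps [simp]:
  "vert_vec G x (Vert i) = (if i \<in> Domain (parcs G) then x i else 0)"
  "vert_vec G x (Wedge i j) = 0"
  "vert_vec G x (Clique i j k) = 0"
  by (simp_all add: vert_vec_def)

lemma vert_vec_ad3_zero:
  assumes G: "pair_graph G"
  shows "vert_vec G x \<in> ad3_zero (graph_lie_algebra G)"
proof -
  interpret pair_graph G by fact
  have "vert_vec G x b = 0" if "b \<notin> graph_basis G" for b
    using that in_arcsD1 by (cases b) auto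
  thus ?thesis by (simp add: ad3_zero_graph[OF G] weight_no_cliques)
qed

text \<open>Commuting with \<open>e_j\<close> for a neighbour \<open>j\<close> of \<open>i\<close>
  kills the coordinate at \<open>i\<close>.\<close>

lemma ad3_zero_center_graph:
  fixes x :: "_ \<Rightarrow> 'k::field"
  assumes G: "pair_graph G" and x: "x \<in> ad3_zero (graph_lie_algebra G)"
  shows "x \<in> ad3_zero_center (graph_lie_algebra G) \<longleftrightarrow> (\<forall>i\<in>Domain (parcs G). x (Vert i) = 0)"
proof
  interpret pair_graph G by fact
  assume *: "x \<in> ad3_zero_center (graph_lie_algebra G)"
  show "\<forall>i\<in>Domain (parcs G). x (Vert i) = 0"
  proof
    fix i assume "i \<in> Domain (parcs G)"
    then obtain j where ij: "(i, j) \<in> parcs G" by auto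
    hence j: "j \<in> Domain (parcs G)" and ne: "i \<noteq> j"
      using symD[OF pair_graph_sym[OF G] ij] pair_no_loops[OF ij] by auto
    have "graph_bracket G x (vert_vec G (unit_vec j)) = 0"
      using * vert_vec_ad3_zero[OF G] by (auto simp: ad3_zero_center_def)
    hence "x (Vert i) * vert_vec G (unit_vec j) (Vert j)
        = x (Vert j) * vert_vec G (unit_vec j) (Vert i)"
      using ij unfolding graph_bracket_eq_0_iff[OF G x vert_vec_ad3_zero[OF G]] commutes_def by blast
    thus "x (Vert i) = 0" using j ne by (simp add: unit_vec_def)
  qed
next
  assume *: "\<forall>i\<in>Domain (parcs G). x (Vert i) = 0"
  have "x (Vert i) = 0" "x (Vert j) = 0" if "(i, j) \<in> parcs G" for i j
    using * that symD[OF pair_graph_sym[OF G] that] by auto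
  thus "x \<in> ad3_zero_center (graph_lie_algebra G)"
    using x by (auto simp: ad3_zero_center_def graph_bracket_eq_0_iff[OF G] commutes_def)
qed

section \<open>Lie isomorphisms in coordinates\<close>

lemma graph_vector_expand:
  assumes "pair_graph G" "x \<in> lie_carrier (graph_lie_algebra G)"
  shows "x = (\<Sum>p\<in>graph_basis G. scale_fun (x p) (unit_vec p))"
proof
  fix b
  have "(\<Sum>p\<in>graph_basis G. scale_fun (x p) (unit_vec p)) b
      = (\<Sum>p\<in>graph_basis G. if p = b then x b else 0)"
    unfolding sum_fun_apply by (intro sum.cong) (auto simp: scale_fun_def unit_vec_def)
  thus "x b = (\<Sum>p\<in>graph_basis G. scale_fun (x p) (unit_vec p)) b"
    using assms finite_graph_basis[OF assms(1)] by simp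
qed

lemma pair_graph_arcs:
  assumes "pair_graph G"
  shows "finite (Domain (parcs G))" "parcs G \<subseteq> Domain (parcs G) \<times> Domain (parcs G)"
    "irrefl (parcs G)"
proof -
  interpret pair_graph G by fact
  show "finite (Domain (parcs G))"
    using pair_finite_arcs by (rule finite_Domain)
  show "parcs G \<subseteq> Domain (parcs G) \<times> Domain (parcs G)"
    using symD[OF pair_graph_sym[OF assms]] by (intro subrelI SigmaI DomainI)
  show "irrefl (parcs G)"
    using pair_no_loops by (fastforce simp: irrefl_def)
qed

locale graph_lie_iso =
  fixes G :: "'v::linorder pair_pre_digraph" and H :: "'w::linorder pair_pre_digraph"
    and \<phi> :: "('v basis_index \<Rightarrow> 'k::field) \<Rightarrow> 'w basis_index \<Rightarrow> 'k"
  assumes G: "pair_graph G" and H: "pair_graph H"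
    and iso: "lie_isomorphism (graph_lie_algebra G) (graph_lie_algebra H) \<phi>"
begin

sublocale lie_iso "graph_lie_algebra G" "graph_lie_algebra H" \<phi>
  using lie_algebra_graph_lie_algebra[OF G] lie_algebra_graph_lie_algebra[OF H] iso
  by (simp add: lie_iso_def lie_iso_axioms_def)

lemma expand:
  assumes x: "x \<in> lie_carrier (graph_lie_algebra G)"
  shows "\<phi> x = matrix_image (\<lambda>p. \<phi> (unit_vec p)) (graph_basis G) x"
proof -
  have e: "unit_vec p \<in> lie_carrier (graph_lie_algebra G)" if "p \<in> graph_basis G" for p
    using that by (auto simp: unit_vec_def)
  have "\<phi> x = \<phi> (\<Sum>p\<in>graph_basis G. scale_fun (x p) (unit_vec p))"
    using graph_vector_expand[OF G x] by simp
  also have "\<dots> = (\<Sum>p\<in>graph_basis G. \<phi> (scale_fun (x p) (unit_vec p)))"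
    using L.carrier_scale[OF e] by (intro sum) simp
  also have "\<dots> = (\<Sum>p\<in>graph_basis G. scale_fun (x p) (\<phi> (unit_vec p)))"
    using scale[OF e] by (intro sum.cong) simp_all
  finally show ?thesis
    by (simp add: fun_eq_iff matrix_image_def sum_fun_apply scale_fun_def)
qed

text \<open>The images of the basis vectors are independent because \<open>\<phi>\<close> is
  injective.\<close>

lemma card_basis_le: "card (graph_basis G) \<le> card (graph_basis H)"
proof (rule trivial_kernel_card_le)
  let ?B = "graph_basis G"
  show "trivial_kernel (\<lambda>p. \<phi> (unit_vec p)) ?B (graph_basis H)"
    unfolding trivial_kernel_def
  proof (intro allI impI)
    fix x :: "'v basis_index \<Rightarrow> 'k"
    assume 0: "\<forall>b\<in>graph_basis H. matrix_image (\<lambda>p. \<phi> (unit_vec p)) ?B x b = 0"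
    let ?x = "\<lambda>p. if p \<in> ?B then x p else 0"
    have x: "?x \<in> lie_carrier (graph_lie_algebra G)" by simp
    have eq: "\<phi> ?x = matrix_image (\<lambda>p. \<phi> (unit_vec p)) ?B x"
      unfolding expand[OF x] by (rule matrix_image_restrict) (simp_all add: finite_graph_basis[OF G])
    have "\<phi> ?x b = 0" for b
      using closed[OF x] 0 eq by (cases "b \<in> graph_basis H") simp_all
    hence "\<phi> ?x = 0" by (simp add: fun_eq_iff)
    hence "?x = 0" using eq_zero_iff[OF x] by simp
    show "\<forall>p\<in>?B. x p = 0"
    proof
      fix p assume "p \<in> ?B"
      thus "x p = 0" using fun_cong[OF \<open>?x = 0\<close>, of p] by simp
    qed
  qed
qed (simp_all add: finite_graph_basis G H)

text \<open>Other coordinates of the images are dropped, since commuting inside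
  \<open>ad3_zero\<close> depends on vertex coordinates only.\<close>

definition vert_matrix :: "'v \<Rightarrow> 'w \<Rightarrow> 'k" where
  "vert_matrix i j = \<phi> (unit_vec (Vert i)) (Vert j)"

lemma vert_vec_image:
  "\<phi> (vert_vec G x) (Vert j) = matrix_image vert_matrix (Domain (parcs G)) x j"
proof -
  interpret pair_graph G by (rule G)
  have "\<phi> (vert_vec G x) (Vert j)
      = (\<Sum>p\<in>graph_basis G. vert_vec G x p * \<phi> (unit_vec p) (Vert j))"
    using vert_vec_ad3_zero[OF G, of x] by (subst expand) (auto simp: ad3_zero_def matrix_image_def)
  also have "\<dots> = (\<Sum>p\<in>Vert ` Domain (parcs G). vert_vec G x p * \<phi> (unit_vec p) (Vert j))"
  proof (rule sum.mono_neutral_right[OF finite_graph_basis[OF G]])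
    show "Vert ` Domain (parcs G) \<subseteq> graph_basis G"
      using in_arcsD1 by auto
    show "\<forall>p\<in>graph_basis G - Vert ` Domain (parcs G). vert_vec G x p * \<phi> (unit_vec p) (Vert j) = 0"
      by (auto simp: vert_vec_def split: basis_index.split)
  qed
  also have "\<dots> = matrix_image vert_matrix (Domain (parcs G)) x j"
    by (subst sum.reindex) (auto simp: inj_on_def matrix_image_def vert_matrix_def intro!: sum.cong)
  finally show ?thesis .
qed

text \<open>
  The vertices incident to an edge span a complement of the center of \<open>ad3_zero\<close> in \<open>ad3_zero\<close>.
\<close>

lemma commutation_map_vert_matrix:
  "commutation_map (Domain (parcs G)) (Domain (parcs H)) (parcs G) (parcs H) vert_matrix"
proof -
  have "trivial_kernel vert_matrix (Domain (parcs G)) (Domain (parcs H))"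
    unfolding trivial_kernel_def
  proof (intro allI impI)
    fix x assume 0: "\<forall>j\<in>Domain (parcs H). matrix_image vert_matrix (Domain (parcs G)) x j = 0"
    have x: "vert_vec G x \<in> ad3_zero (graph_lie_algebra G)"
      by (rule vert_vec_ad3_zero[OF G])
    hence c: "vert_vec G x \<in> lie_carrier (graph_lie_algebra G)"
      by (simp add: ad3_zero_def)
    \<comment> \<open>Zero coordinates at all nonisolated vertices make the image central, so the
      vector itself is central.\<close>
    have "\<phi> (vert_vec G x) \<in> ad3_zero_center (graph_lie_algebra H)"
      using 0 x unfolding ad3_zero_center_graph[OF H ad3_zero_iff[OF c, THEN iffD2, OF x]]
      by (simp add: vert_vec_image)
    hence "vert_vec G x \<in> ad3_zero_center (graph_lie_algebra G)"
      using ad3_zero_center_iff[OF c] by simp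
    thus "\<forall>i\<in>Domain (parcs G). x i = 0"
      unfolding ad3_zero_center_graph[OF G x] by simp
  qed
  moreover have "commutes (parcs H) (matrix_image vert_matrix (Domain (parcs G)) x)
      (matrix_image vert_matrix (Domain (parcs G)) y)"
    if xy: "commutes (parcs G) x y" for x y
  proof -
    have *: "vert_vec G z \<in> ad3_zero (graph_lie_algebra G)"
        "vert_vec G z \<in> lie_carrier (graph_lie_algebra G)" for z :: "'v \<Rightarrow> 'k"
      using vert_vec_ad3_zero[OF G, of z] by (simp_all add: ad3_zero_def)
    have "commutes (parcs G) (\<lambda>i. vert_vec G x (Vert i)) (\<lambda>i. vert_vec G y (Vert i))"
      unfolding commutes_def
    proof (intro allI impI)
      fix i j assume ij: "(i, j) \<in> parcs G"
      hence "i \<in> Domain (parcs G)" "j \<in> Domain (parcs G)" using pair_graph_arcs(2)[OF G] by blast+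
      moreover have "x i * y j = x j * y i" using xy ij unfolding commutes_def by blast
      ultimately show "vert_vec G x (Vert i) * vert_vec G y (Vert j)
          = vert_vec G x (Vert j) * vert_vec G y (Vert i)"
        by (simp only: vert_vec_simps if_True)
    qed
    hence "graph_bracket G (vert_vec G x) (vert_vec G y) = 0"
      using graph_bracket_eq_0_iff[OF G *(1) *(1)] by simp
    hence "graph_bracket H (\<phi> (vert_vec G x)) (\<phi> (vert_vec G y)) = 0"
      using bracket[OF *(2) *(2), of x y] zero by simp
    hence "commutes (parcs H) (\<lambda>j. \<phi> (vert_vec G x) (Vert j)) (\<lambda>j. \<phi> (vert_vec G y) (Vert j))"
      using graph_bracket_eq_0_iff[OF H ad3_zero_iff[OF *(2), THEN iffD2, OF *(1)]
          ad3_zero_iff[OF *(2), THEN iffD2, OF *(1)]] by blast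
    thus ?thesis by (simp only: vert_vec_image)
  qed
  ultimately show ?thesis
    using pair_graph_arcs[OF G] pair_graph_arcs[OF H] pair_graph_sym[OF G] pair_graph_sym[OF H]
    by (intro commutation_map.intro) assumption+
qed

end

section \<open>Basis indices as cliques\<close>

fun index_list :: "'v basis_index \<Rightarrow> 'v list" where
  "index_list (Vert i) = [i]"
| "index_list (Wedge i j) = [i, j]"
| "index_list (Clique i j k) = [i, j, k]"

text \<open>Basis indices without their ordering, so that a graph isomorphism can act on them
  without being monotone.\<close>

definition small_cliques :: "'v::linorder pair_pre_digraph \<Rightarrow> 'v set set" where
  "small_cliques G = {S. S \<subseteq> pverts G \<and> card S \<in> {1, 2, 3} \<and> pairwise (\<lambda>i j. (i, j) \<in> parcs G) S}"

lemma graph_basis_sorted: "p \<in> graph_basis G \<Longrightarrow> sorted_wrt (<) (index_list p)"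
  by (cases p) auto

lemma index_list_inj: "index_list p = index_list q \<Longrightarrow> p = q"
  by (cases p; cases q) auto

text \<open>A clique of one to three vertices has a unique increasing enumeration, whose length
  determines the constructor.\<close>

lemma bij_betw_small_cliques:
  assumes G: "pair_graph G"
  shows "bij_betw (\<lambda>p. set (index_list p)) (graph_basis G) (small_cliques G)"
  unfolding bij_betw_def
proof (intro conjI equalityI subsetI)
  interpret pair_graph G by (rule G)
  have sym: "(j, i) \<in> parcs G" if "(i, j) \<in> parcs G" for i j
    using that by (rule symD[OF pair_graph_sym[OF G]])
  show "inj_on (\<lambda>p. set (index_list p)) (graph_basis G)"
    by (intro inj_onI index_list_inj strict_sorted_equal graph_basis_sorted)
  fix S
  {
    assume "S \<in> (\<lambda>p. set (index_list p)) ` graph_basis G"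
    then obtain p where p: "p \<in> graph_basis G" and S: "S = set (index_list p)" by blast
    have "card S = length (index_list p)"
      unfolding S using graph_basis_sorted[OF p] by (simp add: distinct_card strict_sorted_iff)
    hence "card S \<in> {1, 2, 3}" by (cases p) auto
    moreover have "S \<subseteq> pverts G"
      using p in_arcsD1 in_arcsD2 unfolding S by (cases p) auto
    moreover have "pairwise (\<lambda>i j. (i, j) \<in> parcs G) S"
      using p sym unfolding S by (cases p) (simp_all add: pairwise_insert, blast+)
    ultimately show "S \<in> small_cliques G" by (simp add: small_cliques_def)
  next
    assume S: "S \<in> small_cliques G"
    define xs where "xs = sorted_list_of_set S"
    have "finite S" using S by (auto simp: small_cliques_def intro: card_ge_0_finite)
    hence xs: "set xs = S" "sorted_wrt (<) xs" "length xs = card S"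
      by (simp_all add: xs_def)
    have V: "set xs \<subseteq> pverts G" and adj: "pairwise (\<lambda>i j. (i, j) \<in> parcs G) (set xs)"
      and len: "length xs \<in> {1, 2, 3}"
      using S xs by (simp_all add: small_cliques_def)
    from len consider i where "xs = [i]" | i j where "xs = [i, j]" | i j k where "xs = [i, j, k]"
      by (auto simp: numeral_2_eq_2 numeral_3_eq_3 length_Suc_conv)
    hence "\<exists>p\<in>graph_basis G. index_list p = xs"
    proof cases
      case 1
      thus ?thesis using V by (intro bexI[of _ "Vert i"]) auto
    next
      case (2 i j)
      thus ?thesis using adj xs(2) by (intro bexI[of _ "Wedge i j"]) (auto simp: pairwise_insert)
    next
      case (3 i j k)
      thus ?thesis using adj xs(2) by (intro bexI[of _ "Clique i j k"]) (auto simp: pairwise_insert)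
    qed
    thus "S \<in> (\<lambda>p. set (index_list p)) ` graph_basis G" using xs(1) by blast
  }
qed

section \<open>The Lie isomorphism induced by a graph isomorphism\<close>

lemma length_index_list:
  assumes "p \<in> graph_basis G"
  shows "length (index_list p) = card (set (index_list p))"
  using graph_basis_sorted[OF assms] by (simp add: distinct_card strict_sorted_iff)

lemma clique_mem_eq:
  "clique_mem p a = (if length (index_list p) = 3 \<and> a \<in> set (index_list p) then 1 else 0)"
  by (cases p) simp_all

locale graph_iso =
  fixes G :: "'v::linorder pair_pre_digraph" and H :: "'w::linorder pair_pre_digraph"
    and f :: "'v \<Rightarrow> 'w"
  assumes G: "pair_graph G" and H: "pair_graph H"
    and f: "bij_betw f (pverts G) (pverts H)"
    and adjacent: "\<lbrakk>i \<in> pverts G; j \<in> pverts G\<rbrakk> \<Longrightarrow> (f i, f j) \<in> parcs H \<longleftrightarrow> (i, j) \<in> parcs G"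
begin

lemma inj: "\<lbrakk>i \<in> pverts G; j \<in> pverts G\<rbrakk> \<Longrightarrow> f i = f j \<longleftrightarrow> i = j"
  using f by (auto simp: bij_betw_def dest: inj_onD)

lemma small_clique_image:
  assumes "S \<subseteq> pverts G"
  shows "f ` S \<in> small_cliques H \<longleftrightarrow> S \<in> small_cliques G"
proof -
  have "inj_on f S" "f ` S \<subseteq> pverts H"
    using f assms by (auto simp: bij_betw_def intro: inj_on_subset)
  moreover from this have "pairwise (\<lambda>i j. (i, j) \<in> parcs H) (f ` S) \<longleftrightarrow>
      pairwise (\<lambda>i j. (i, j) \<in> parcs G) S"
    using assms adjacent inj by (auto simp: pairwise_def inj_on_def subset_iff)
  ultimately show ?thesis using assms by (simp add: small_cliques_def card_image)
qed

lemma bij_small_cliques: "bij_betw ((`) f) (small_cliques G) (small_cliques H)"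
  unfolding bij_betw_def
proof (intro conjI equalityI subsetI)
  show "inj_on ((`) f) (small_cliques G)"
    using f by (auto intro!: inj_onI simp: small_cliques_def bij_betw_def inj_on_image_eq_iff)
  fix T
  {
    assume "T \<in> (`) f ` small_cliques G"
    then obtain S where S: "S \<in> small_cliques G" "T = f ` S" by blast
    hence "S \<subseteq> pverts G" by (simp add: small_cliques_def)
    thus "T \<in> small_cliques H" using S small_clique_image by simp
  next
    assume T: "T \<in> small_cliques H"
    hence "T \<subseteq> f ` pverts G" using f by (simp add: small_cliques_def bij_betw_def)
    then obtain S where S: "S \<subseteq> pverts G" "T = f ` S" by (auto simp: subset_image_iff)
    thus "T \<in> (`) f ` small_cliques G" using T small_clique_image by auto
  }
qed

text \<open>Applies \<open>f\<close> to the vertices of an index and sorts the result in the order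
  of \<open>H\<close>.\<close>

definition basis_map :: "'v basis_index \<Rightarrow> 'w basis_index" where
  "basis_map p = inv_into (graph_basis H) (\<lambda>q. set (index_list q)) (f ` set (index_list p))"

lemma bij_basis_map: "bij_betw basis_map (graph_basis G) (graph_basis H)"
  using bij_betw_trans[OF bij_betw_trans[OF bij_betw_small_cliques[OF G] bij_small_cliques]
      bij_betw_inv_into[OF bij_betw_small_cliques[OF H]]]
  by (simp add: basis_map_def[abs_def] comp_def)

lemma basis_map_in: "p \<in> graph_basis G \<Longrightarrow> basis_map p \<in> graph_basis H"
  using bij_basis_map by (auto simp: bij_betw_def)

lemma basis_map_eq_iff:
  "\<lbrakk>p \<in> graph_basis G; q \<in> graph_basis G\<rbrakk> \<Longrightarrow> basis_map p = basis_map q \<longleftrightarrow> p = q"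
  using bij_basis_map by (auto simp: bij_betw_def dest: inj_onD)

lemma basis_mapI:
  assumes "q \<in> graph_basis H" "set (index_list q) = f ` set (index_list p)"
  shows "basis_map p = q"
  using bij_betw_inv_into_left[OF bij_betw_small_cliques[OF H] assms(1)] assms(2)
  by (simp add: basis_map_def)

lemma set_index_list_basis_map:
  assumes "p \<in> graph_basis G"
  shows "set (index_list (basis_map p)) = f ` set (index_list p)"
proof -
  have "f ` set (index_list p) \<in> small_cliques H"
    using bij_betw_small_cliques[OF G] bij_small_cliques assms by (auto simp: bij_betw_def)
  thus ?thesis
    using bij_betw_inv_into_right[OF bij_betw_small_cliques[OF H]] by (simp add: basis_map_def)
qed

lemma set_index_list_subset: "p \<in> graph_basis G \<Longrightarrow> set (index_list p) \<subseteq> pverts G"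
  using bij_betw_small_cliques[OF G] by (auto simp: bij_betw_def small_cliques_def)

lemma length_basis_map:
  assumes "p \<in> graph_basis G"
  shows "length (index_list (basis_map p)) = length (index_list p)"
proof -
  have "inj_on f (set (index_list p))"
    using f set_index_list_subset[OF assms] by (auto simp: bij_betw_def intro: inj_on_subset)
  thus ?thesis
    using assms
    by (simp add: length_index_list[OF basis_map_in] length_index_list set_index_list_basis_map card_image)
qed

lemma clique_mem_basis_map:
  assumes "p \<in> graph_basis G" "a \<in> pverts G"
  shows "clique_mem (basis_map p) (f a) = (clique_mem p a :: 'k::field)"
proof -
  have "f a \<in> f ` set (index_list p) \<longleftrightarrow> a \<in> set (index_list p)"
    using inj assms set_index_list_subset[OF assms(1)] by (auto simp: subset_iff)
  thus ?thesis
    by (simp add: clique_mem_eq length_basis_map[OF assms(1)] set_index_list_basis_map[OF assms(1)])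
qed

lemma basis_map_Vert: "a \<in> pverts G \<Longrightarrow> basis_map (Vert a) = Vert (f a)"
  using f by (intro basis_mapI) (auto simp: bij_betw_def)

lemma basis_map_Wedge:
  assumes "Wedge a b \<in> graph_basis G"
  shows "f a < f b \<Longrightarrow> basis_map (Wedge a b) = Wedge (f a) (f b)"
    and "\<not> f a < f b \<Longrightarrow> basis_map (Wedge a b) = Wedge (f b) (f a) \<and> f b < f a"
proof -
  interpret pair_graph G by (rule G)
  have ab: "a < b" "(a, b) \<in> parcs G" "a \<in> pverts G" "b \<in> pverts G"
    using assms in_arcsD1 in_arcsD2 by auto
  hence fab: "(f a, f b) \<in> parcs H" and "f a \<noteq> f b"
    using adjacent inj by auto
  hence fba: "(f b, f a) \<in> parcs H" using symD[OF pair_graph_sym[OF H]] by blast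
  show "basis_map (Wedge a b) = Wedge (f a) (f b)" if "f a < f b"
    using fab that by (intro basis_mapI) auto
  assume "\<not> f a < f b"
  hence "f b < f a" using \<open>f a \<noteq> f b\<close> by simp
  moreover from this have "basis_map (Wedge a b) = Wedge (f b) (f a)"
    using fba by (intro basis_mapI) auto
  ultimately show "basis_map (Wedge a b) = Wedge (f b) (f a) \<and> f b < f a" by simp
qed

text \<open>Sorting the images of the two ends may flip a wedge; cliques stand for symmetric
  products and carry no sign.\<close>

definition index_sign :: "'v basis_index \<Rightarrow> 'k::field" where
  "index_sign p = (case p of Wedge i j \<Rightarrow> if f i < f j then 1 else - 1 | _ \<Rightarrow> 1)"

lemma index_sign_simps [simp]:
  "index_sign (Vert a) = 1"
  "index_sign (Clique i j k) = 1"
  "index_sign p * index_sign p = 1"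
  by (cases p; simp add: index_sign_def)+

text \<open>An index with a nontrivial sign is a wedge and contributes no weight, so signs drop out
  of products with \<open>clique_mem\<close>.\<close>

lemma index_sign_cases:
  obtains "index_sign p = (1 :: 'k::field)" | "\<And>a. clique_mem p a = (0 :: 'k)"
  by (cases p) simp_all

text \<open>The index tests and \<open>clique_mem\<close> values in the coordinate formulas are
  invariant under \<open>basis_map\<close>, which leaves only signs to compare.\<close>

lemma basis_bracket_basis_map:
  assumes p: "p \<in> graph_basis G" and q: "q \<in> graph_basis G" and b: "b \<in> graph_basis G"
  shows "basis_bracket H (basis_map p) (basis_map q) (basis_map b)
    = index_sign p * index_sign q * index_sign b * (basis_bracket G p q b :: 'k::field)"
proof (cases b)
  case (Vert a)
  hence a: "a \<in> pverts G" using b by simp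
  have eq: "basis_map p = Vert (f a) \<longleftrightarrow> p = Vert a" if "p \<in> graph_basis G" for p
    using basis_map_eq_iff[OF that b] a by (simp add: Vert basis_map_Vert)
  show ?thesis
    unfolding Vert basis_map_Vert[OF a] basis_bracket_Vert eq[OF p] eq[OF q]
      clique_mem_basis_map[OF p a] clique_mem_basis_map[OF q a]
    by (cases p rule: index_sign_cases[where 'k = 'k]; cases q rule: index_sign_cases[where 'k = 'k];
        cases "p = Vert a"; cases "q = Vert a"; simp)
next
  case (Wedge a c)
  interpret pair_graph G by (rule G)
  have ac: "a < c" "(a, c) \<in> parcs G" using b Wedge by simp_all
  hence V: "a \<in> pverts G" "c \<in> pverts G" using in_arcsD1 in_arcsD2 by blast+
  have ne: "a \<noteq> c" using ac by simp
  have VB: "Vert a \<in> graph_basis G" "Vert c \<in> graph_basis G" using V by simp_all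
  have eq: "basis_map p = Vert (f a) \<longleftrightarrow> p = Vert a" "basis_map p = Vert (f c) \<longleftrightarrow> p = Vert c"
    "basis_map p = basis_map (Wedge a c) \<longleftrightarrow> p = Wedge a c" if "p \<in> graph_basis G" for p
    using basis_map_eq_iff[OF that VB(1)] basis_map_eq_iff[OF that VB(2)]
      basis_map_eq_iff[OF that b] V by (simp_all add: Wedge basis_map_Vert)
  note cm = clique_mem_basis_map[OF p V(1)] clique_mem_basis_map[OF p V(2)]
    clique_mem_basis_map[OF q V(1)] clique_mem_basis_map[OF q V(2)]
  have fac: "(f a, f c) \<in> parcs H" using ac V adjacent by simp
  hence fca: "(f c, f a) \<in> parcs H" using symD[OF pair_graph_sym[OF H]] by blast
  note W = basis_map_Wedge[OF b[unfolded Wedge]]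
  show ?thesis
  proof (cases "f a < f c")
    case True
    hence s: "index_sign (Wedge a c) = (1 :: 'k)" by (simp add: index_sign_def)
    show ?thesis
      unfolding Wedge W(1)[OF True] basis_bracket_Wedge[OF H True fac] basis_bracket_Wedge[OF G ac]
        eq(1,2)[OF p] eq(1,2)[OF q] eq(3)[OF p, unfolded W(1)[OF True]]
        eq(3)[OF q, unfolded W(1)[OF True]] cm
      using ne
      by (cases p rule: index_sign_cases[where 'k = 'k]; cases q rule: index_sign_cases[where 'k = 'k];
          cases "p = Vert a"; cases "p = Vert c"; cases "p = Wedge a c";
          cases "q = Vert a"; cases "q = Vert c"; cases "q = Wedge a c"; simp add: s)
  next
    \<comment> \<open>The image of \<open>Wedge a c\<close> is reversed: the vertex terms change
      sign, matching the sign of \<open>b\<close>, while in the other terms the sign occurs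
      twice.\<close>
    case False
    hence s: "index_sign (Wedge a c) = (- 1 :: 'k)" by (simp add: index_sign_def)
    note W' = W(2)[OF False, THEN conjunct1]
    show ?thesis
      unfolding Wedge W' basis_bracket_Wedge[OF H W(2)[OF False, THEN conjunct2] fca]
        basis_bracket_Wedge[OF G ac]
        eq(1,2)[OF p] eq(1,2)[OF q] eq(3)[OF p, unfolded W'] eq(3)[OF q, unfolded W'] cm
      using ne
      by (cases p rule: index_sign_cases[where 'k = 'k]; cases q rule: index_sign_cases[where 'k = 'k];
          cases "p = Vert a"; cases "p = Vert c"; cases "p = Wedge a c";
          cases "q = Vert a"; cases "q = Vert c"; cases "q = Wedge a c"; simp add: s)
  qed
next
  case (Clique i j k)
  hence "length (index_list (basis_map b)) = 3"
    using length_basis_map[OF b] by simp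
  then obtain i' j' k' where "basis_map b = Clique i' j' k'"
    by (cases "basis_map b") auto
  thus ?thesis by (simp add: Clique basis_bracket_Clique)
qed

text \<open>Pulls coordinates back along \<open>basis_map\<close>, so the Lie map runs from
  \<open>H\<close> to \<open>G\<close>; the value zero off the basis keeps it in the
  carrier.\<close>

definition coordinate_change :: "('w basis_index \<Rightarrow> 'k::field) \<Rightarrow> 'v basis_index \<Rightarrow> 'k" where
  "coordinate_change y p = (if p \<in> graph_basis G then index_sign p * y (basis_map p) else 0)"

lemma coordinate_change_bracket:
  "coordinate_change (graph_bracket H x y)
    = graph_bracket G (coordinate_change x) (coordinate_change y :: _ \<Rightarrow> 'k::field)"
proof
  fix b
  let ?B = "graph_basis G"
  show "coordinate_change (graph_bracket H x y) b
      = graph_bracket G (coordinate_change x) (coordinate_change y :: _ \<Rightarrow> 'k) b"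
  proof (cases "b \<in> ?B")
    case b: True
    have "graph_bracket H x y (basis_map b) = (\<Sum>p\<in>?B. \<Sum>q\<in>?B.
        x (basis_map p) * y (basis_map q) * basis_bracket H (basis_map p) (basis_map q) (basis_map b))"
      unfolding graph_bracket_apply
      by (simp add: sum.reindex_bij_betw[OF bij_basis_map, symmetric])
    hence "coordinate_change (graph_bracket H x y) b = (\<Sum>p\<in>?B. \<Sum>q\<in>?B. index_sign b *
        (x (basis_map p) * y (basis_map q) * basis_bracket H (basis_map p) (basis_map q) (basis_map b)))"
      using b by (simp add: coordinate_change_def sum_distrib_left)
    also have "\<dots> = (\<Sum>p\<in>?B. \<Sum>q\<in>?B.
        coordinate_change x p * coordinate_change y q * basis_bracket G p q b)"
    proof (intro sum.cong refl)
      fix p q assume pq: "p \<in> ?B" "q \<in> ?B"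
      have "index_sign b * (x (basis_map p) * y (basis_map q)
            * (index_sign p * index_sign q * index_sign b * basis_bracket G p q b))
          = (index_sign b * index_sign b) * (index_sign p * x (basis_map p) *
            (index_sign q * y (basis_map q)) * basis_bracket G p q b)"
        by (simp only: mult_ac)
      thus "index_sign b * (x (basis_map p) * y (basis_map q)
            * basis_bracket H (basis_map p) (basis_map q) (basis_map b))
          = coordinate_change x p * coordinate_change y q * basis_bracket G p q b"
        using pq by (simp add: basis_bracket_basis_map[OF pq b] coordinate_change_def)
    qed
    finally show ?thesis by (simp add: graph_bracket_apply)
  qed (simp add: coordinate_change_def graph_bracket_outside[OF G])
qed

lemma lie_isomorphism_coordinate_change:
  "lie_isomorphism (graph_lie_algebra H :: ('k::field, _) lie_struct) (graph_lie_algebra G)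
     coordinate_change"
proof -
  let ?inv = "inv_into (graph_basis G) basis_map"
  have inv: "?inv b \<in> graph_basis G" "basis_map (?inv b) = b" if "b \<in> graph_basis H" for b
    using that bij_basis_map by (auto simp: bij_betw_def inv_into_into f_inv_into_f)
  have inv': "?inv (basis_map p) = p" if "p \<in> graph_basis G" for p
    using that bij_basis_map by (simp add: bij_betw_def)
  have sign: "index_sign p * (index_sign p * c) = (c :: 'k)" for p c
    by (simp add: mult.assoc[symmetric])
  have "bij_betw (coordinate_change :: _ \<Rightarrow> _ \<Rightarrow> 'k) (lie_carrier (graph_lie_algebra H))
      (lie_carrier (graph_lie_algebra G))"
    \<comment> \<open>Signs square to one, so the inverse reuses them.\<close>
    by (rule bij_betw_byWitness[where
          f' = "\<lambda>x b. if b \<in> graph_basis H then index_sign (?inv b) * x (?inv b) else 0"])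
      (auto simp: coordinate_change_def fun_eq_iff inv inv' basis_map_in sign)
  thus ?thesis
    by (simp add: lie_isomorphism_def coordinate_change_bracket)
      (auto simp: coordinate_change_def scale_fun_def fun_eq_iff algebra_simps)
qed

lemma lie_isomorphic:
  "lie_isomorphic (graph_lie_algebra G :: ('k::field, _) lie_struct) (graph_lie_algebra H)"
proof -
  interpret lie_iso "graph_lie_algebra H :: ('k, _) lie_struct" "graph_lie_algebra G" coordinate_change
    using lie_algebra_graph_lie_algebra[OF G] lie_algebra_graph_lie_algebra[OF H]
      lie_isomorphism_coordinate_change
    by (simp add: lie_iso_def lie_iso_axioms_def)
  show ?thesis using inverse by (auto simp: lie_isomorphic_def)
qed

end

section \<open>Isomorphic Lie algebras come from isomorphic graphs\<close>

text \<open>An isolated vertex contributes only its own basis vector.\<close>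

lemma card_graph_basis_isolated:
  assumes G: "pair_graph G"
  shows "card (graph_basis G)
    = card (graph_basis (G\<lparr>pverts := Domain (parcs G)\<rparr>)) + card (pverts G - Domain (parcs G))"
    and "pair_graph (G\<lparr>pverts := Domain (parcs G)\<rparr>)"
proof -
  interpret pair_graph G by (rule G)
  let ?G = "G\<lparr>pverts := Domain (parcs G)\<rparr>"
  have sym: "sym (parcs G)" by (rule pair_graph_sym[OF G])
  show G': "pair_graph ?G"
    using pair_graph_arcs[OF G] sym pair_finite_arcs pair_no_loops
    by unfold_locales (auto simp: symmetric_def)
  have "graph_basis G = graph_basis ?G \<union> Vert ` (pverts G - Domain (parcs G))"
    using in_arcsD1 by (auto simp: graph_basis_def)
  moreover have "graph_basis ?G \<inter> Vert ` (pverts G - Domain (parcs G)) = {}"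
    by (auto simp: graph_basis_def)
  ultimately show "card (graph_basis G) = card (graph_basis ?G) + card (pverts G - Domain (parcs G))"
    using finite_graph_basis[OF G'] pair_finite_verts
    by (simp add: card_Un_disjoint card_image inj_on_def)
qed

lemma lie_isomorphic_imp_graph_iso:
  fixes G :: "'v::linorder pair_pre_digraph" and H :: "'w::linorder pair_pre_digraph"
  assumes G: "pair_graph G" and H: "pair_graph H"
    and iso: "lie_isomorphic (graph_lie_algebra G :: ('k::field, _) lie_struct) (graph_lie_algebra H)"
  obtains f where "graph_iso G H f"
proof -
  let ?V = "Domain (parcs G)" and ?W = "Domain (parcs H)"
  from iso obtain \<phi> where \<phi>:
    "lie_isomorphism (graph_lie_algebra G :: ('k, _) lie_struct) (graph_lie_algebra H) \<phi>"
    by (auto simp: lie_isomorphic_def)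
  then interpret A: graph_lie_iso G H \<phi>
    using G H by (intro graph_lie_iso.intro)
  interpret B: graph_lie_iso H G "inv_into (lie_carrier (graph_lie_algebra G)) \<phi>"
    using G H A.inverse by (intro graph_lie_iso.intro)
  obtain \<sigma> where \<sigma>: "bij_betw \<sigma> ?V ?W"
      "\<And>i j. \<lbrakk>i \<in> ?V; j \<in> ?V\<rbrakk> \<Longrightarrow> (i, j) \<in> parcs G \<longleftrightarrow> (\<sigma> i, \<sigma> j) \<in> parcs H"
    using commutation_maps_imp_graph_iso[OF A.commutation_map_vert_matrix B.commutation_map_vert_matrix]
    by blast
  interpret S: graph_iso "G\<lparr>pverts := ?V\<rparr>" "H\<lparr>pverts := ?W\<rparr>" \<sigma>
    using card_graph_basis_isolated(2)[OF G] card_graph_basis_isolated(2)[OF H] \<sigma>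
    by (intro graph_iso.intro) simp_all
  \<comment> \<open>The bijection \<open>\<sigma>\<close> makes the basis parts of the nonisolated
    subgraphs equal in size, so equal total dimensions leave equally many isolated vertices.\<close>
  have "card (pverts G - ?V) = card (pverts H - ?W)"
    using A.card_basis_le B.card_basis_le bij_betw_same_card[OF S.bij_basis_map]
    by (simp add: card_graph_basis_isolated(1)[OF G] card_graph_basis_isolated(1)[OF H])
  moreover interpret G: pair_graph G by (rule G)
  interpret H: pair_graph H by (rule H)
  have sub: "?V \<subseteq> pverts G" "?W \<subseteq> pverts H" using G.in_arcsD1 H.in_arcsD1 by blast+
  ultimately obtain \<tau> where \<tau>: "bij_betw \<tau> (pverts G - ?V) (pverts H - ?W)"
    using finite_same_card_bij[of "pverts G - ?V" "pverts H - ?W"] G.pair_finite_verts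
      H.pair_finite_verts by auto
  let ?f = "\<lambda>i. if i \<in> ?V then \<sigma> i else \<tau> i"
  have "bij_betw ?f (?V \<union> (pverts G - ?V)) (?W \<union> (pverts H - ?W))"
    using \<sigma>(1) \<tau> by (intro bij_betw_disjoint_Un) auto
  moreover have "(?f i, ?f j) \<in> parcs H \<longleftrightarrow> (i, j) \<in> parcs G"
    if ij: "i \<in> pverts G" "j \<in> pverts G" for i j
  proof (cases "i \<in> ?V \<and> j \<in> ?V")
    case True
    thus ?thesis using \<sigma>(2) by auto
  next
    case False
    have "\<tau> l \<notin> ?W" if "l \<in> pverts G - ?V" for l
      using \<tau> that by (auto simp: bij_betw_def)
    hence "?f i \<notin> ?W \<or> ?f j \<notin> ?W" using False ij by auto
    hence "(?f i, ?f j) \<notin> parcs H" using pair_graph_arcs(2)[OF H] by blast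
    moreover have "(i, j) \<notin> parcs G" using False pair_graph_arcs(2)[OF G] by blast
    ultimately show ?thesis by simp
  qed
  ultimately have "graph_iso G H ?f"
    using G H sub by (intro graph_iso.intro) (simp_all add: Un_absorb1)
  thus thesis by (rule that)
qed

theorem theorem3p4:
  fixes G :: "'v::linorder pair_pre_digraph" and H :: "'w::linorder pair_pre_digraph"
  assumes "pair_graph G" and "pair_graph H"
  shows "lie_isomorphic
           (graph_lie_algebra G :: ('k::field, 'v basis_index \<Rightarrow> 'k) lie_struct)
           (graph_lie_algebra H :: ('k, 'w basis_index \<Rightarrow> 'k) lie_struct)
         \<longleftrightarrow> digraph_iso (with_proj G) (with_proj H)"
proof -
  have "digraph_iso (with_proj G) (with_proj H) \<longleftrightarrow> (\<exists>f. graph_iso G H f)"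
    unfolding digraph_iso_pair_graph_iff[OF assms] graph_iso_def using assms by blast
  thus ?thesis
    using graph_iso.lie_isomorphic lie_isomorphic_imp_graph_iso[OF assms] by blast
qed

end
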